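(* Let $\tau$ be the Toeplitz substitution on $\{0,1\}$ given by $\tau(0)=01$, $\tau(1)=00$. Up to renaming of symbols, there are exactly three injective primitive substitutions $\beta$ of constant length $2$ such that $(X_\beta,\sigma)$ is topologically conjugate to $(X_\tau,\sigma)$, namely: (1) Toeplitz: $1\to 12,\ 2\to 11$; (2) rotated Toeplitz: $1\to 21,\ 2\to 11$; (3) $3$-symbol Toeplitz: $1\to 23,\ 2\to 13,\ 3\to 12$.
   Context: An alphabet is a finite set $A$ with at least two elements. A substitution on $A$ is a map $\alpha:A\to A^*$, extended to finite and infinite words by juxtaposition; it has constant length $L$ if $\alpha(a)\in A^L$ for every $a\in A$. It is injective if $\alpha(a)\ne\alpha(b)$ for distinct letters $a,b$. It is primitive if for some $n>0$ and every $a\in A$ the word $\alpha^n(a)$ contains every letter of $A$. The language $\mathcal{L}_\alpha\subseteq A^*$ is the set of all factors (words of consecutive letters) of words $\alpha^n(a)$, $a\in A$, $n\ge 1$. $X_\alpha\subseteq A^{\mathbb{Z}}$ is the set of bi-infinite sequences all of whose finite factors lie in $\mathcal{L}_\alpha$, and $\sigma$ is the left shift. Two systems are topologically conjugate if there is a homeomorphism between them commuting with $\sigma$. Substitutions differing only by a bijective renaming of the symbols of the alphabet are regarded as the same. *)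

theory Defs
  imports "HOL-Analysis.Analysis" "HOL-Library.Sublist"
begin

definition alphabet :: "'a set \<Rightarrow> bool" where
  "alphabet A \<longleftrightarrow> finite A \<and> 2 \<le> card A"

text \<open>A substitution on \<open>A\<close> is represented by a total function on the ambient type; only its values
  on \<open>A\<close> are relevant, and none of the notions below depends on its values outside \<open>A\<close>
  once \<^term>\<open>\<forall>a\<in>A. \<alpha> a \<in> lists A\<close>.\<close>

definition substitution_on :: "'a set \<Rightarrow> ('a \<Rightarrow> 'a list) \<Rightarrow> bool" where
  "substitution_on A \<alpha> \<longleftrightarrow> (\<forall>a\<in>A. \<alpha> a \<in> lists A)"

definition subst_word :: "('a \<Rightarrow> 'a list) \<Rightarrow> 'a list \<Rightarrow> 'a list" where
  "subst_word \<alpha> w = concat (map \<alpha> w)"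

definition subst_iter :: "('a \<Rightarrow> 'a list) \<Rightarrow> nat \<Rightarrow> 'a \<Rightarrow> 'a list" where
  "subst_iter \<alpha> n a = (subst_word \<alpha> ^^ n) [a]"

definition constant_length :: "'a set \<Rightarrow> ('a \<Rightarrow> 'a list) \<Rightarrow> nat \<Rightarrow> bool" where
  "constant_length A \<alpha> L \<longleftrightarrow> (\<forall>a\<in>A. length (\<alpha> a) = L)"

definition primitive_subst :: "'a set \<Rightarrow> ('a \<Rightarrow> 'a list) \<Rightarrow> bool" where
  "primitive_subst A \<alpha> \<longleftrightarrow> (\<exists>n>0. \<forall>a\<in>A. A \<subseteq> set (subst_iter \<alpha> n a))"

definition subst_language :: "'a set \<Rightarrow> ('a \<Rightarrow> 'a list) \<Rightarrow> 'a list set" where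
  "subst_language A \<alpha> = {w. \<exists>a\<in>A. \<exists>n\<ge>1. sublist w (subst_iter \<alpha> n a)}"

definition factor_at :: "(int \<Rightarrow> 'a) \<Rightarrow> int \<Rightarrow> nat \<Rightarrow> 'a list" where
  "factor_at x i n = map (\<lambda>k. x (i + int k)) [0..<n]"

definition subst_shift :: "'a set \<Rightarrow> ('a \<Rightarrow> 'a list) \<Rightarrow> (int \<Rightarrow> 'a) set" where
  "subst_shift A \<alpha> = {x \<in> UNIV \<rightarrow> A. \<forall>i n. factor_at x i n \<in> subst_language A \<alpha>}"

definition subst_top :: "'a set \<Rightarrow> ('a \<Rightarrow> 'a list) \<Rightarrow> (int \<Rightarrow> 'a) topology" where
  "subst_top A \<alpha> =
     subtopology (product_topology (\<lambda>_. discrete_topology A) UNIV) (subst_shift A \<alpha>)"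

definition left_shift :: "(int \<Rightarrow> 'a) \<Rightarrow> int \<Rightarrow> 'a" where
  "left_shift x = (\<lambda>i. x (i + 1))"

definition topologically_conjugate ::
    "'x topology \<Rightarrow> ('x \<Rightarrow> 'x) \<Rightarrow> 'y topology \<Rightarrow> ('y \<Rightarrow> 'y) \<Rightarrow> bool" where
  "topologically_conjugate X S Y T \<longleftrightarrow>
     (\<exists>h. homeomorphic_map X Y h \<and> (\<forall>x\<in>topspace X. h (S x) = T (h x)))"

definition same_up_to_renaming ::
    "'a set \<Rightarrow> ('a \<Rightarrow> 'a list) \<Rightarrow> 'b set \<Rightarrow> ('b \<Rightarrow> 'b list) \<Rightarrow> bool" where
  "same_up_to_renaming A \<alpha> B \<beta> \<longleftrightarrow>
     (\<exists>\<phi>. bij_betw \<phi> A B \<and> (\<forall>a\<in>A. \<beta> (\<phi> a) = map \<phi> (\<alpha> a)))"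

definition tau :: "nat \<Rightarrow> nat list" where
  "tau = (\<lambda>_. [])(0 := [0,1], 1 := [0,0])"

definition toeplitz :: "nat \<Rightarrow> nat list" where
  "toeplitz = (\<lambda>_. [])(1 := [1,2], 2 := [1,1])"

definition rotated_toeplitz :: "nat \<Rightarrow> nat list" where
  "rotated_toeplitz = (\<lambda>_. [])(1 := [2,1], 2 := [1,1])"

definition toeplitz3 :: "nat \<Rightarrow> nat list" where
  "toeplitz3 = (\<lambda>_. [])(1 := [2,3], 2 := [1,3], 3 := [1,2])"

definition in_toeplitz_class :: "'a set \<Rightarrow> ('a \<Rightarrow> 'a list) \<Rightarrow> bool" where
  "in_toeplitz_class A \<beta> \<longleftrightarrow>
     alphabet A \<and> substitution_on A \<beta> \<and> constant_length A \<beta> 2 \<and>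
     inj_on \<beta> A \<and> primitive_subst A \<beta> \<and>
     topologically_conjugate (subst_top A \<beta>) left_shift (subst_top {0, 1} tau) left_shift"

end

(* Write X for the Toeplitz shift. A point of X is, in exactly one way, a shift by 0 or 1 of
   tau(y) with y in X, because the symbols 1 occupy positions of one parity only.
   Desubstituting a shift-commuting continuous map C on X (that is, writing C o tau as a shift
   of tau o D) shrinks its window, so after finitely many steps it is a one-block map, hence a
   power of the shift; climbing back, every endomorphism of X is a power of the shift.

   Let now h be a conjugacy from X_beta to X, with inverse g. The map h o beta o g doubles shifts,
   hence it is a shift of tau o C for an endomorphism C, hence a shift of tau. After
   composing g with a suitable power of the shift, beta o g = g o tau holds exactly. As beta is
   injective on letters, this equation again shrinks the window of g, down to {-1, 0}. The words
   of length two in X are 01, 00, 10; let p, q, r be their images. Then beta maps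
   p to rq, q to rp and r to qp, and these are all letters. Now p = r would collapse the alphabet,
   q = r gives Toeplitz, p = q gives rotated Toeplitz, and distinct letters give 3-symbol
   Toeplitz. Conversely each of these tables makes the 2-block code a conjugacy. *)
theory Submission
  imports Defs
begin

subsection \<open>Substitutions on bi-infinite sequences\<close>

definition shift :: "int \<Rightarrow> (int \<Rightarrow> 'a) \<Rightarrow> int \<Rightarrow> 'a" where
  "shift k x = (\<lambda>i. x (i + k))"

text \<open>Specialised to length 2, with the origin fixed: the image of the symbol at
  \<open>k\<close> occupies \<open>2 * k\<close> and \<open>2 * k + 1\<close>.\<close>

definition seq_subst :: "('a \<Rightarrow> 'a list) \<Rightarrow> (int \<Rightarrow> 'a) \<Rightarrow> int \<Rightarrow> 'a" where
  "seq_subst \<alpha> x = (\<lambda>i. \<alpha> (x (i div 2)) ! nat (i mod 2))"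

lemma shift_apply [simp]: "shift k x i = x (i + k)"
  by (simp add: shift_def)

lemma shift_0 [simp]: "shift 0 x = x"
  by (simp add: shift_def)

lemma shift_shift [simp]: "shift k (shift l x) = shift (k + l) x"
  by (rule ext) (simp add: algebra_simps)

lemma left_shift_eq_shift: "left_shift = shift 1"
  by (simp add: left_shift_def shift_def fun_eq_iff)

lemma seq_subst_shift: "seq_subst \<alpha> (shift k x) = shift (2 * k) (seq_subst \<alpha> x)"
  by (rule ext) (simp add: seq_subst_def add.commute)

lemma factor_at_shift: "factor_at (shift k x) i n = factor_at x (i + k) n"
  by (simp add: factor_at_def algebra_simps)

lemma length_factor_at [simp]: "length (factor_at x i n) = n"
  by (simp add: factor_at_def)

lemma nth_factor_at [simp]: "k < n \<Longrightarrow> factor_at x i n ! k = x (i + int k)"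
  by (simp add: factor_at_def)

lemma factor_at_eq_iff:
  "factor_at x i n = factor_at y j n \<longleftrightarrow> (\<forall>k<n. x (i + int k) = y (j + int k))"
  by (auto simp: list_eq_iff_nth_eq)

lemma factor_at_add: "factor_at x i (m + n) = factor_at x i m @ factor_at x (i + int m) n"
  by (rule nth_equalityI) (auto simp: nth_append)

lemma sublist_factor_at:
  assumes "j \<le> i" "i + int n \<le> j + int m"
  shows "sublist (factor_at x i n) (factor_at x j m)"
proof -
  define p where "p = nat (i - j)"
  have p: "i = j + int p" using assms by (simp add: p_def)
  then obtain s where s: "m = p + (n + s)"
    using assms by (metis add.assoc le_Suc_ex of_nat_add of_nat_le_iff add_le_cancel_left)
  show ?thesis unfolding s factor_at_add p sublist_def by blast
qed

lemma sublist_factor_atD: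
  assumes "sublist w (factor_at x j m)"
  obtains i where "j \<le> i" "i + int (length w) \<le> j + int m" "w = factor_at x i (length w)"
proof -
  obtain p s where *: "factor_at x j m = p @ w @ s"
    using assms by (auto simp: sublist_def)
  have m: "m = length p + (length w + length s)"
    using arg_cong[OF *, of length] by simp
  have "w = factor_at x (j + int (length p)) (length w)"
    using * unfolding m factor_at_add by simp
  then show ?thesis using that[of "j + int (length p)"] m by simp
qed

lemma subst_word_append: "subst_word \<alpha> (u @ v) = subst_word \<alpha> u @ subst_word \<alpha> v"
  by (simp add: subst_word_def)

lemma sublist_subst_word:
  assumes "sublist u v"
  shows "sublist (subst_word \<alpha> u) (subst_word \<alpha> v)"
  using assms by (auto simp: sublist_def subst_word_append) blast

lemma subst_word_in_language:
  assumes "w \<in> subst_language A \<alpha>"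
  shows "subst_word \<alpha> w \<in> subst_language A \<alpha>"
proof -
  obtain a n where an: "a \<in> A" "n \<ge> 1" "sublist w (subst_iter \<alpha> n a)"
    using assms by (auto simp: subst_language_def)
  have "sublist (subst_word \<alpha> w) (subst_iter \<alpha> (Suc n) a)"
    using sublist_subst_word[OF an(3)] by (simp add: subst_iter_def)
  then show ?thesis using an by (auto simp: subst_language_def intro!: bexI[of _ a] exI[of _ "Suc n"])
qed

lemma sublist_in_language:
  "sublist u w \<Longrightarrow> w \<in> subst_language A \<alpha> \<Longrightarrow> u \<in> subst_language A \<alpha>"
  unfolding subst_language_def by (blast intro: sublist_order.order.trans)

lemma factor_at_seq_subst:
  assumes "constant_length A \<alpha> 2" "x \<in> UNIV \<rightarrow> A"
  shows "factor_at (seq_subst \<alpha> x) (2 * i) (2 * n) = subst_word \<alpha> (factor_at x i n)"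
proof (induction n)
  case (Suc n)
  have l: "length (\<alpha> (x (i + int n))) = 2"
    using assms by (auto simp: constant_length_def Pi_iff)
  have "factor_at (seq_subst \<alpha> x) (2 * i + int (2 * n)) 2 = \<alpha> (x (i + int n))"
  proof (rule nth_equalityI)
    fix k assume "k < length (factor_at (seq_subst \<alpha> x) (2 * i + int (2 * n)) 2)"
    then have "k = 0 \<or> k = 1" by auto
    moreover have "(2 * i + 2 * int n) div 2 = i + int n"
      "(1 + (2 * i + 2 * int n)) div 2 = i + int n"
      "(1 + (2 * i + 2 * int n)) mod 2 = 1"
      by presburger+
    ultimately show "factor_at (seq_subst \<alpha> x) (2 * i + int (2 * n)) 2 ! k = \<alpha> (x (i + int n)) ! k"
      by (auto simp: seq_subst_def add.commute)
  qed (simp add: l)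
  moreover have "subst_word \<alpha> (factor_at x i (Suc n))
      = subst_word \<alpha> (factor_at x i n) @ \<alpha> (x (i + int n))"
    using factor_at_add[of x i n 1] subst_word_append by (simp add: factor_at_def subst_word_def)
  ultimately show ?case
    using Suc factor_at_add[of "seq_subst \<alpha> x" "2 * i" "2 * n" 2] by (simp add: add.commute)
qed (simp add: factor_at_def subst_word_def)

locale two_subst =
  fixes A :: "'a set" and \<alpha> :: "'a \<Rightarrow> 'a list"
  assumes len: "constant_length A \<alpha> 2" and sub: "substitution_on A \<alpha>"
begin

lemma seq_subst_in: "x \<in> UNIV \<rightarrow> A \<Longrightarrow> seq_subst \<alpha> x \<in> UNIV \<rightarrow> A"
proof
  fix i assume x: "x \<in> UNIV \<rightarrow> A"
  then have "length (\<alpha> (x (i div 2))) = 2" "\<alpha> (x (i div 2)) \<in> lists A"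
    using len sub by (auto simp: constant_length_def substitution_on_def Pi_iff)
  moreover have "nat (i mod 2) < 2" by simp
  ultimately show "seq_subst \<alpha> x i \<in> A"
    by (simp add: seq_subst_def in_lists_conv_set)
qed

lemma funpow_seq_subst_in: "x \<in> UNIV \<rightarrow> A \<Longrightarrow> (seq_subst \<alpha> ^^ m) x \<in> UNIV \<rightarrow> A"
  by (induction m) (use seq_subst_in in auto)

text \<open>Links the language, built by iterating on letters, with the map on sequences: a letter
  occurring in \<open>x\<close> has its \<open>m\<close>-th iterate displayed as a window of the
  \<open>m\<close>-th image of \<open>x\<close>.\<close>

lemma factor_at_funpow_seq_subst:
  assumes "x \<in> UNIV \<rightarrow> A"
  shows "factor_at ((seq_subst \<alpha> ^^ m) x) (2 ^ m * i) (2 ^ m) = subst_iter \<alpha> m (x i)"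
proof -
  \<comment> \<open>Stated for blocks of \<open>n\<close> letters, since each induction step reads a
    whole word rather than one letter.\<close>
  have "factor_at ((seq_subst \<alpha> ^^ m) x) (2 ^ m * i) (2 ^ m * n)
      = (subst_word \<alpha> ^^ m) (factor_at x i n)" for n
  proof (induction m)
    case (Suc m)
    then show ?case
      using factor_at_seq_subst[OF len funpow_seq_subst_in[OF assms, of m],
          of "2 ^ m * i" "2 ^ m * n"]
      by (simp add: mult.assoc)
  qed simp
  from this[of 1] show ?thesis
    by (simp add: subst_iter_def factor_at_def)
qed

lemma seq_subst_shift_in:
  assumes "x \<in> subst_shift A \<alpha>"
  shows "seq_subst \<alpha> x \<in> subst_shift A \<alpha>"
proof -
  have x: "x \<in> UNIV \<rightarrow> A" using assms by (simp add: subst_shift_def)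
  have "factor_at (seq_subst \<alpha> x) i n \<in> subst_language A \<alpha>" for i n
  proof (rule sublist_in_language)
    \<comment> \<open>An arbitrary window is enlarged to one that starts at an even position and
      consists of complete images of letters; \<open>n + 1\<close> images suffice for either parity
      of \<open>i\<close>.\<close>
    show "sublist (factor_at (seq_subst \<alpha> x) i n) (factor_at (seq_subst \<alpha> x) (2 * (i div 2)) (2 * (n + 1)))"
      by (rule sublist_factor_at) auto
    show "factor_at (seq_subst \<alpha> x) (2 * (i div 2)) (2 * (n + 1)) \<in> subst_language A \<alpha>"
      unfolding factor_at_seq_subst[OF len x]
      using assms by (intro subst_word_in_language) (simp add: subst_shift_def)
  qed
  then show ?thesis using seq_subst_in[OF x] by (simp add: subst_shift_def)
qed

lemma funpow_seq_subst_shift_in: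
  "x \<in> subst_shift A \<alpha> \<Longrightarrow> (seq_subst \<alpha> ^^ m) x \<in> subst_shift A \<alpha>"
  by (induction m) (use seq_subst_shift_in in auto)

lemma inj_seq_subst:
  assumes "inj_on \<alpha> A" "a \<in> A" "b \<in> A" "\<alpha> a ! 0 = \<alpha> b ! 0" "\<alpha> a ! 1 = \<alpha> b ! 1"
  shows "a = b"
proof -
  have "length (\<alpha> a) = 2" "length (\<alpha> b) = 2" using len assms by (auto simp: constant_length_def)
  then have "\<alpha> a = \<alpha> b" using assms(4,5) by (auto intro!: nth_equalityI simp: less_2_cases_iff)
  then show ?thesis using assms by (auto dest: inj_onD)
qed

end

lemma shift_in_subst_shift: "x \<in> subst_shift A \<alpha> \<Longrightarrow> shift k x \<in> subst_shift A \<alpha>"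
  by (auto simp: subst_shift_def factor_at_shift)

subsection \<open>The Toeplitz sequence\<close>

text \<open>The Toeplitz sequence has a hole at \<open>-1\<close>; as \<open>multiplicity 2 0 = 0\<close>,
  the formula below fills it with the symbol \<open>0\<close>.\<close>

definition zseq :: "int \<Rightarrow> nat" where
  "zseq i = multiplicity 2 (i + 1) mod 2"

lemma tau_simps [simp]: "tau 0 = [0, 1]" "tau 1 = [0, 0]" "tau (Suc 0) = [0, 0]"
  by (simp_all add: tau_def)

interpretation tau: two_subst "{0, 1}" tau
  by unfold_locales (auto simp: constant_length_def substitution_on_def tau_def)

abbreviation Xt :: "(int \<Rightarrow> nat) set" where "Xt \<equiv> subst_shift {0, 1} tau"
abbreviation T :: "(int \<Rightarrow> nat) \<Rightarrow> int \<Rightarrow> nat" where "T \<equiv> seq_subst tau"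

lemma Xt_range: "x \<in> Xt \<Longrightarrow> x i = 0 \<or> x i = 1"
  by (auto simp: subst_shift_def Pi_iff)

lemma T_even: "x i \<in> {0, 1} \<Longrightarrow> T x (2 * i) = 0"
  by (auto simp: seq_subst_def)

lemma T_odd: "x i \<in> {0, 1} \<Longrightarrow> T x (2 * i + 1) = 1 - x i"
  by (auto simp: seq_subst_def)

section \<open>The Toeplitz sequence under the substitution\<close>

lemma zseq_in: "zseq i \<in> {0, 1}"
  by (auto simp: zseq_def)

lemma zseq_in_Pi: "zseq \<in> UNIV \<rightarrow> {0, 1}"
  using zseq_in by auto

lemma zseq_even: "zseq (2 * i) = 0"
  unfolding zseq_def by (subst not_dvd_imp_multiplicity_0) auto

text \<open>Doubling \<open>i + 1\<close> raises its 2-adic valuation by one and so flips the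
  symbol. At the hole \<open>i = -1\<close> doubling changes nothing, hence the exception.\<close>

lemma zseq_odd: "i \<noteq> -1 \<Longrightarrow> zseq (2 * i + 1) = 1 - zseq i"
proof -
  assume "i \<noteq> -1"
  then have "multiplicity 2 (2 * (i + 1)) = Suc (multiplicity 2 (i + 1))"
    by (subst multiplicity_times_same) auto
  then show ?thesis unfolding zseq_def
    by (auto simp: algebra_simps mod_Suc)
qed

lemma zseq_values [simp]: "zseq 0 = 0" "zseq 1 = 1" "zseq 2 = 0" "zseq 3 = 0" "zseq (-1) = 0"
  using zseq_even[of 0] zseq_odd[of 0] zseq_even[of 1] zseq_odd[of 1]
  by (auto simp: zseq_def)

lemma zseq_1_mod_4: "zseq (4 * i + 1) = 1"
  using zseq_odd[of "2 * i"] zseq_even[of i] by (simp add: mult.assoc[symmetric]) presburger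

text \<open>The recursion for \<open>T\<close> is that of \<open>zseq\<close> except at the hole,
  the one place where a symbol depends on itself. There \<open>T\<close> flips the symbol, so
  \<open>T\<close> composed with itself fixes \<open>zseq\<close>.\<close>

lemma T_zseq: "T zseq = zseq(-1 := 1)"
proof
  fix i :: int
  obtain k where "i = 2 * k \<or> i = 2 * k + 1" by (metis oddE evenE)
  then show "T zseq i = (zseq(-1 := 1)) i"
    using zseq_in[of k] T_even[of zseq k] T_odd[of zseq k] zseq_even[of k] zseq_odd[of k]
    by (cases "k = -1") auto
qed

lemma T_T_zseq: "T (T zseq) = zseq"
proof
  fix i :: int
  obtain k where k: "i = 2 * k \<or> i = 2 * k + 1" by (metis oddE evenE)
  have in01: "T zseq k \<in> {0,1}" using zseq_in[of k] by (auto simp: T_zseq)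
  show "T (T zseq) i = zseq i"
    using k T_even[of "T zseq" k, OF in01] T_odd[of "T zseq" k, OF in01] zseq_even[of k] zseq_odd[of k]
    by (cases "k = -1") (auto simp: T_zseq)
qed

lemma T_pow_zseq: "(T ^^ m) zseq = (if even m then zseq else zseq(-1 := 1))"
proof (induction m)
  case (Suc m)
  then show ?case using T_zseq T_T_zseq by (cases "even m") (simp_all only: funpow.simps comp_apply even_Suc if_True if_False simp_thms)
qed simp

text \<open>Adding a power of two keeps every smaller valuation. At the hole, \<open>0\<close>
  becomes \<open>4 ^ m\<close>, of valuation \<open>2 * m\<close>; this is even and agrees with the
  filling \<open>0\<close>, which is why powers of 4 are taken.\<close>

lemma zseq_period:
  assumes "\<bar>i + 1\<bar> < 4 ^ m"
  shows "zseq (i + 4 ^ m) = zseq i"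
proof -
  have *: "multiplicity 2 ((2::int) ^ (2 * m)) = 2 * m" by simp
  have e: "(4::int) ^ m = 2 ^ (2 * m)" by (simp add: power_mult)
  show ?thesis
  proof (cases "i = -1")
    case True
    then show ?thesis unfolding zseq_def e by (simp add: *)
  next
    case False
    have "multiplicity 2 (i + 1) < 2 * m"
    proof (rule ccontr)
      assume "\<not> ?thesis"
      then have "(2::int) ^ (2 * m) dvd i + 1" by (intro multiplicity_dvd') simp
      then have "\<bar>2 ^ (2 * m)\<bar> \<le> \<bar>i + 1\<bar>" using False by (intro dvd_imp_le_int) auto
      then show False using assms e by simp
    qed
    then have "multiplicity 2 ((i + 1) + 2 ^ (2 * m)) = multiplicity 2 (i + 1)"
      using False by (intro multiplicity_sum_lt) (simp_all add: *)
    then show ?thesis unfolding zseq_def e by (simp add: algebra_simps)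
  qed
qed

text \<open>Both letters occur in \<open>zseq\<close> at nonnegative positions, and iterating
  \<open>T\<close> alters \<open>zseq\<close> only at \<open>-1\<close>; so every iterate of a
  letter is read off \<open>zseq\<close> itself on the nonnegative side.\<close>

lemma tau_language_iff:
  "w \<in> subst_language {0, 1} tau \<longleftrightarrow> (\<exists>j\<ge>0. w = factor_at zseq j (length w))"
proof
  assume "w \<in> subst_language {0, 1} tau"
  then obtain a m where a: "a \<in> {0, 1}" "sublist w (subst_iter tau m a)"
    by (auto simp: subst_language_def)
  \<comment> \<open>A nonnegative position where \<open>zseq\<close> shows the letter
    \<open>a\<close>.\<close>
  define c :: int where "c = (if a = 0 then 0 else 1)"
  have c: "zseq c = a" "c \<ge> 0" using a by (auto simp: c_def zseq_values)
  have "subst_iter tau m a = factor_at ((T ^^ m) zseq) (2 ^ m * c) (2 ^ m)"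
    using tau.factor_at_funpow_seq_subst[OF zseq_in_Pi, of m c] c by simp
  also have "\<dots> = factor_at zseq (2 ^ m * c) (2 ^ m)"
  proof -
    have "2 ^ m * c + int k \<noteq> -1" for k
      using c(2) by (smt (verit) mult_nonneg_nonneg of_nat_0_le_iff zero_le_power)
    then show ?thesis by (auto simp: factor_at_eq_iff T_pow_zseq)
  qed
  finally obtain j where "2 ^ m * c \<le> j" "w = factor_at zseq j (length w)"
    using a(2) by (metis sublist_factor_atD)
  then show "\<exists>j\<ge>0. w = factor_at zseq j (length w)"
    using c(2) by (metis mult_nonneg_nonneg order_trans zero_le_numeral zero_le_power)
next
  assume "\<exists>j\<ge>0. w = factor_at zseq j (length w)"
  then obtain j where j: "j \<ge> 0" "w = factor_at zseq j (length w)" by blast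
  \<comment> \<open>The exponent will be \<open>2 * n\<close>: even, so that \<open>T\<close>
    iterated fixes \<open>zseq\<close>, positive, and large enough for the prefix of length
    \<open>2 ^ (2 * n)\<close> to contain the window.\<close>
  define n where "n = nat j + length w + 1"
  have "j + int (length w) \<le> int n" using j by (simp add: n_def)
  also have "n \<le> 2 ^ (2 * n)" by (rule order.trans[OF _ less_imp_le[OF less_exp]]) simp
  then have "int n \<le> int (2 ^ (2 * n))" by (simp only: of_nat_le_iff)
  finally have "sublist (factor_at zseq j (length w)) (factor_at zseq (2 ^ (2*n) * 0) (2 ^ (2*n)))"
    using j(1) by (intro sublist_factor_at) auto
  also have "factor_at zseq (2 ^ (2*n) * 0) (2 ^ (2*n)) = subst_iter tau (2 * n) 0"
    using tau.factor_at_funpow_seq_subst[OF zseq_in_Pi, of "2*n" 0]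
    by (simp add: T_pow_zseq zseq_values)
  finally show "w \<in> subst_language {0, 1} tau"
    using j(2) by (auto simp: subst_language_def n_def intro!: exI[of _ "2*n"])
qed

text \<open>Points of X are the limits of translates of \<open>zseq\<close>;
  \<open>c \<ge> int N\<close> keeps the copied window on the nonnegative side, away from the
  hole.\<close>

lemma Xt_iff: "x \<in> Xt \<longleftrightarrow> (\<forall>N::nat. \<exists>c\<ge>int N. \<forall>i. \<bar>i\<bar> \<le> int N \<longrightarrow> x i = zseq (i + c))"
proof
  assume x: "x \<in> Xt"
  show "\<forall>N::nat. \<exists>c\<ge>int N. \<forall>i. \<bar>i\<bar> \<le> int N \<longrightarrow> x i = zseq (i + c)"
  proof
    fix N :: nat
    have "factor_at x (- int N) (2 * N + 1) \<in> subst_language {0, 1} tau"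
      using x by (simp add: subst_shift_def)
    then obtain j where j: "j \<ge> 0" "factor_at x (- int N) (2 * N + 1) = factor_at zseq j (2 * N + 1)"
      unfolding tau_language_iff length_factor_at by blast
    have "x i = zseq (i + (j + int N))" if "\<bar>i\<bar> \<le> int N" for i
    proof -
      have k: "int (nat (i + int N)) = i + int N" "nat (i + int N) < 2 * N + 1" using that by auto
      show ?thesis
        using j(2)[unfolded factor_at_eq_iff, rule_format, OF k(2)] unfolding k(1)
        by (simp add: algebra_simps)
    qed
    then show "\<exists>c\<ge>int N. \<forall>i. \<bar>i\<bar> \<le> int N \<longrightarrow> x i = zseq (i + c)"
      using j(1) by (intro exI[of _ "j + int N"]) auto
  qed
next
  assume *: "\<forall>N::nat. \<exists>c\<ge>int N. \<forall>i. \<bar>i\<bar> \<le> int N \<longrightarrow> x i = zseq (i + c)"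
  have "x i \<in> {0, 1}" for i
    using *[rule_format, of "nat \<bar>i\<bar>"] zseq_in by (metis abs_ge_zero int_nat_eq order_refl)
  moreover have "factor_at x i n \<in> subst_language {0, 1} tau" for i n
  proof -
    obtain c where c: "c \<ge> int (nat \<bar>i\<bar> + n)" "\<And>k. \<bar>k\<bar> \<le> int (nat \<bar>i\<bar> + n) \<Longrightarrow> x k = zseq (k + c)"
      using * by blast
    have "factor_at x i n = factor_at zseq (i + c) n"
      unfolding factor_at_eq_iff using c(2) by (auto simp: algebra_simps)
    moreover have "0 \<le> i + c" using c(1) by linarith
    ultimately show ?thesis unfolding tau_language_iff length_factor_at by blast
  qed
  ultimately show "x \<in> Xt" by (auto simp: subst_shift_def)
qed

lemma zseq_in_Xt: "zseq \<in> Xt"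
  unfolding Xt_iff
proof
  fix N :: nat
  have "N + 1 < 4 ^ (N + 1)" using power_gt_expt[of 4 "N+1"] by simp
  then have "int (N + 1) < int (4 ^ (N + 1))" by (simp only: of_nat_less_iff)
  then have N: "int N + 1 < 4 ^ (N + 1)" by simp
  show "\<exists>c\<ge>int N. \<forall>i. \<bar>i\<bar> \<le> int N \<longrightarrow> zseq i = zseq (i + c)"
    by (rule exI[of _ "4 ^ (N + 1)"]) (use N zseq_period[of _ "N + 1"] in auto)
qed

section \<open>Desubstitution in the Toeplitz shift\<close>

lemma T_in_Xt: "x \<in> Xt \<Longrightarrow> T x \<in> Xt"
  by (rule tau.seq_subst_shift_in)

lemma T_Xt_even: "x \<in> Xt \<Longrightarrow> T x (2 * i) = 0"
  by (rule T_even) (use Xt_range in auto)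

lemma T_Xt_odd: "x \<in> Xt \<Longrightarrow> T x (2 * i + 1) = 1 - x i"
  by (rule T_odd) (use Xt_range in auto)

text \<open>The translates \<open>c N\<close> of \<open>zseq\<close> that approximate
  \<open>x\<close> all have the same parity \<open>e\<close>, because one fixed symbol 1 of
  \<open>x\<close> must land on an odd position of \<open>zseq\<close>. The odd positions then spell
  out \<open>y\<close>.\<close>

lemma Xt_desubst:
  assumes "x \<in> Xt"
  obtains e y where "e \<in> {0, 1}" "y \<in> Xt" "x = shift e (T y)"
proof -
  obtain c where c: "\<And>N::nat. c N \<ge> int N" "\<And>N i. \<bar>i\<bar> \<le> int N \<Longrightarrow> x i = zseq (i + c N)"
    using assms[unfolded Xt_iff] by metis
  \<comment> \<open>Chosen so that \<open>i0 + c 3\<close> is 1 modulo 4, where \<open>zseq\<close>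
    is 1; \<open>i0\<close> lies inside the window of radius 3.\<close>
  define i0 where "i0 = (1 - c 3) mod 4"
  have i0: "0 \<le> i0" "i0 < 4" by (auto simp: i0_def)
  have i0c: "i0 + c 3 = 4 * ((i0 + c 3) div 4) + 1" unfolding i0_def by presburger
  have "x i0 = zseq (i0 + c 3)" using c(2)[of i0 3] i0 by simp
  then have x1: "x i0 = 1" using zseq_1_mod_4[of "(i0 + c 3) div 4"] i0c by simp
  define e where "e = (i0 + 1) mod 2"
  have par: "even (c N - e)" if "N \<ge> 3" for N
  proof -
    have "zseq (i0 + c N) = 1" using c(2)[of i0 N] that i0 x1 by auto
    then have "odd (i0 + c N)" using zseq_even by (metis dvd_def zero_neq_one)
    then show ?thesis unfolding e_def by presburger
  qed
  \<comment> \<open>Forced by \<open>T_Xt_odd\<close>: position \<open>2 * k + 1\<close> of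
    \<open>T y\<close> has to carry \<open>1 - y k\<close>.\<close>
  define y where "y k = 1 - x (2 * k + 1 - e)" for k
  have e: "e \<in> {0, 1}" unfolding e_def by auto
  have yz: "y k = zseq (k + (c N - e) div 2)" if "N \<ge> 3" "\<bar>2 * k + 1 - e\<bar> \<le> int N" for N k
  proof -
    have "even (c N - e)" by (rule par) fact
    then obtain d where "c N - e = 2 * d" by (elim dvdE)
    then have d: "c N = 2 * d + e" by simp
    \<comment> \<open>Excludes the hole, so that \<open>zseq_odd\<close> applies at
      \<open>k + d\<close>.\<close>
    have ge: "k + d \<ge> 0" using c(1)[of N] that(2) d e by auto
    have "x (2 * k + 1 - e) = zseq (2 * (k + d) + 1)"
      using c(2)[OF that(2)] d by (simp add: algebra_simps)
    then show ?thesis using zseq_odd[of "k + d"] ge zseq_in[of "k + d"] d by (auto simp: y_def)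
  qed
  have "y \<in> Xt" unfolding Xt_iff
  proof
    fix N :: nat
    show "\<exists>c\<ge>int N. \<forall>i. \<bar>i\<bar> \<le> int N \<longrightarrow> y i = zseq (i + c)"
      by (rule exI[of _ "(c (2 * N + 3) - e) div 2"])
        (use c(1)[of "2 * N + 3"] e yz[of "2 * N + 3"] in auto)
  qed
  moreover have "x = shift e (T y)"
  proof
    fix i
    obtain k where "i + e = 2 * k \<or> i + e = 2 * k + 1" by (metis oddE evenE)
    then show "x i = shift e (T y) i"
    proof
      assume k: "i + e = 2 * k"
      define N where "N = nat \<bar>i\<bar> + 3"
      have "even (c N - e)" by (rule par) (simp add: N_def)
      then have "even (i + c N)" using k by presburger
      then obtain d where "i + c N = 2 * d" by (elim evenE)
      then have "x i = 0" using c(2)[of i N] zseq_even[of d] by (simp add: N_def)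
      then show ?thesis using T_Xt_even[OF \<open>y \<in> Xt\<close>, of k] by (simp add: k)
    next
      assume k: "i + e = 2 * k + 1"
      then have i: "i = 2 * k + 1 - e" by simp
      have "x i = 1 - y k" using Xt_range[OF assms, of i] unfolding y_def i by auto
      then show ?thesis using T_Xt_odd[OF \<open>y \<in> Xt\<close>, of k] by (simp add: k)
    qed
  qed
  ultimately show ?thesis using that e by blast
qed

subsection \<open>Continuous maps between substitution shifts\<close>

definition agree :: "nat \<Rightarrow> (int \<Rightarrow> 'a) \<Rightarrow> (int \<Rightarrow> 'a) \<Rightarrow> bool" where
  "agree N x y \<longleftrightarrow> (\<forall>i. \<bar>i\<bar> \<le> int N \<longrightarrow> x i = y i)"

text \<open>Uniform finite dependence of each coordinate. Commutation with the shift is left out so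
  that shift-doubling maps such as \<open>seq_subst\<close> are covered too.\<close>

definition local_on :: "(int \<Rightarrow> 'a) set \<Rightarrow> ((int \<Rightarrow> 'a) \<Rightarrow> int \<Rightarrow> 'b) \<Rightarrow> bool" where
  "local_on X F \<longleftrightarrow> (\<forall>j. \<exists>N. \<forall>x\<in>X. \<forall>y\<in>X. agree N x y \<longrightarrow> F x j = F y j)"

lemma agree_refl [simp]: "agree N x x"
  by (simp add: agree_def)

lemma agree_trans: "agree N x y \<Longrightarrow> agree N y z \<Longrightarrow> agree N x z"
  by (simp add: agree_def)

lemma agree_mono: "agree N x y \<Longrightarrow> M \<le> N \<Longrightarrow> agree M x y"
  by (simp add: agree_def)

text \<open>A basic open set restricts finitely many coordinates, and these lie in a symmetric
  window; conversely, a window determines a basic open set.\<close>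

lemma openin_full_shift_iff:
  "openin (product_topology (\<lambda>_::int. discrete_topology A) UNIV) S \<longleftrightarrow>
     S \<subseteq> UNIV \<rightarrow> A \<and> (\<forall>x\<in>S. \<exists>N. \<forall>y\<in>UNIV \<rightarrow> A. agree N x y \<longrightarrow> y \<in> S)" (is "?L \<longleftrightarrow> ?R")
proof
  assume L: ?L
  have "S \<subseteq> UNIV \<rightarrow> A" using openin_subset[OF L] by (simp add: PiE_UNIV_domain)
  moreover have "\<exists>N. \<forall>y\<in>UNIV \<rightarrow> A. agree N x y \<longrightarrow> y \<in> S" if xS: "x \<in> S" for x
  proof -
    obtain U where U: "finite {i. U i \<noteq> A}" "x \<in> Pi UNIV U" "Pi UNIV U \<subseteq> S"
      using L xS unfolding openin_product_topology_alt by (auto simp: PiE_UNIV_domain)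
    obtain b where b: "\<And>i. U i \<noteq> A \<Longrightarrow> \<bar>i\<bar> \<le> b"
      using U(1) unfolding finite_int_iff_bounded_le by blast
    have "y \<in> S" if y: "y \<in> UNIV \<rightarrow> A" and a: "agree (nat b) x y" for y
    proof -
      have "y i \<in> U i" for i
      proof (cases "U i = A")
        case False
        then have "\<bar>i\<bar> \<le> int (nat b)" using b[of i] by linarith
        then have "x i = y i" using a unfolding agree_def by blast
        then show ?thesis using U(2) by (metis PiE UNIV_I)
      qed (use y in auto)
      then show ?thesis using U(3) by auto
    qed
    then show ?thesis by blast
  qed
  ultimately show ?R by blast
next
  assume R: ?R
  show ?L unfolding openin_product_topology_alt
  proof
    fix x assume x: "x \<in> S"
    then obtain N where N: "\<And>y. y \<in> UNIV \<rightarrow> A \<Longrightarrow> agree N x y \<Longrightarrow> y \<in> S" using R by blast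
    have xA: "x i \<in> A" for i using R x by blast
    define U where "U i = (if \<bar>i\<bar> \<le> int N then {x i} else A)" for i :: int
    have "finite {i. U i \<noteq> A}"
      by (rule finite_subset[of _ "{- int N..int N}"]) (auto simp: U_def)
    moreover have "Pi UNIV U \<subseteq> S"
    proof
      fix y assume y: "y \<in> Pi UNIV U"
      have "y i \<in> A \<and> (\<bar>i\<bar> \<le> int N \<longrightarrow> x i = y i)" for i
        using Pi_mem[OF y, of i] xA[of i] by (auto simp: U_def split: if_splits)
      then show "y \<in> S" using N by (auto simp: agree_def)
    qed
    moreover have "x \<in> Pi UNIV U" "\<And>i. U i \<subseteq> A" using xA by (auto simp: U_def)
    ultimately show "\<exists>U. finite {i \<in> UNIV. U i \<noteq> topspace (discrete_topology A)} \<and>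
        (\<forall>i\<in>UNIV. openin (discrete_topology A) (U i)) \<and> x \<in> Pi\<^sub>E UNIV U \<and> Pi\<^sub>E UNIV U \<subseteq> S"
      by (intro exI[of _ U]) (simp add: PiE_UNIV_domain)
  qed
qed

section \<open>Topology of a substitution shift through windows\<close>

lemma subst_shift_subset: "subst_shift A \<alpha> \<subseteq> UNIV \<rightarrow> A"
  by (auto simp: subst_shift_def)

lemma topspace_subst_top [simp]: "topspace (subst_top A \<alpha>) = subst_shift A \<alpha>"
  using subst_shift_subset[of A \<alpha>] by (auto simp: subst_top_def PiE_UNIV_domain)

lemma openin_subst_top_iff:
  "openin (subst_top A \<alpha>) S \<longleftrightarrow>
     S \<subseteq> subst_shift A \<alpha> \<and> (\<forall>x\<in>S. \<exists>N. \<forall>y\<in>subst_shift A \<alpha>. agree N x y \<longrightarrow> y \<in> S)" (is "?L \<longleftrightarrow> ?R")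
proof
  assume ?L
  then obtain S' where S': "openin (product_topology (\<lambda>_::int. discrete_topology A) UNIV) S'"
    "S = S' \<inter> subst_shift A \<alpha>"
    by (auto simp: subst_top_def openin_subtopology)
  show ?R unfolding S'(2)
  proof (intro conjI ballI)
    fix x assume x: "x \<in> S' \<inter> subst_shift A \<alpha>"
    then obtain N where "\<forall>y\<in>UNIV \<rightarrow> A. agree N x y \<longrightarrow> y \<in> S'"
      using S'(1) unfolding openin_full_shift_iff by blast
    then show "\<exists>N. \<forall>y\<in>subst_shift A \<alpha>. agree N x y \<longrightarrow> y \<in> S' \<inter> subst_shift A \<alpha>"
      using subst_shift_subset by blast
  qed auto
next
  assume R: ?R
  \<comment> \<open>Union of the cylinders whose trace on the shift lies in \<open>S\<close>: an
    open set of the full shift that cuts out \<open>S\<close>.\<close>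
  define S' where "S' = {y \<in> UNIV \<rightarrow> A. \<exists>x\<in>S. \<exists>N. (\<forall>y'\<in>subst_shift A \<alpha>. agree N x y' \<longrightarrow> y' \<in> S) \<and> agree N x y}"
  have "openin (product_topology (\<lambda>_::int. discrete_topology A) UNIV) S'"
    unfolding openin_full_shift_iff S'_def using agree_trans by blast
  moreover have "S = S' \<inter> subst_shift A \<alpha>"
  proof
    show "S \<subseteq> S' \<inter> subst_shift A \<alpha>"
    proof
      fix x assume x: "x \<in> S"
      then have "x \<in> subst_shift A \<alpha>" using R by blast
      then show "x \<in> S' \<inter> subst_shift A \<alpha>"
        using R x subst_shift_subset unfolding S'_def by (blast intro: agree_refl)
    qed
  qed (auto simp: S'_def)
  ultimately show ?L by (auto simp: subst_top_def openin_subtopology)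
qed

text \<open>A subshift is closed in the compact full shift, since a forbidden factor is visible in a
  finite window.\<close>

lemma compact_space_subst_top:
  assumes "finite A"
  shows "compact_space (subst_top A \<alpha>)"
proof -
  let ?P = "product_topology (\<lambda>_::int. discrete_topology A) UNIV"
  have "openin ?P (topspace ?P - subst_shift A \<alpha>)"
    unfolding openin_full_shift_iff
  proof (intro conjI[of "_ \<subseteq> _"] ballI)
    fix x assume "x \<in> topspace ?P - subst_shift A \<alpha>"
    then obtain i n where in_def: "factor_at x i n \<notin> subst_language A \<alpha>"
      by (auto simp: subst_shift_def PiE_UNIV_domain)
    have "y \<notin> subst_shift A \<alpha>" if a: "agree (nat \<bar>i\<bar> + n) x y" for y
    proof -
      have "\<bar>i + int k\<bar> \<le> int (nat \<bar>i\<bar> + n)" if "k < n" for k using that by linarith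
      then have "factor_at x i n = factor_at y i n"
        using a unfolding agree_def factor_at_eq_iff by blast
      then show ?thesis using in_def unfolding subst_shift_def by auto
    qed
    then show "\<exists>N. \<forall>y\<in>UNIV \<rightarrow> A. agree N x y \<longrightarrow> y \<in> topspace ?P - subst_shift A \<alpha>"
      unfolding topspace_product_topology topspace_discrete_topology PiE_UNIV_domain by blast
  qed (simp add: PiE_UNIV_domain)
  moreover have "compact_space ?P"
    using assms by (simp add: compact_space_product_topology compact_space_discrete_topology)
  moreover have "subst_shift A \<alpha> \<subseteq> topspace ?P"
    using subst_shift_subset[of A \<alpha>] by (simp add: PiE_UNIV_domain)
  ultimately show ?thesis unfolding subst_top_def
    by (intro compact_space_subtopology closedin_compact_space) (simp_all only: closedin_def simp_thms)
qed

lemma Hausdorff_space_subst_top: "Hausdorff_space (subst_top A \<alpha>)"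
  unfolding subst_top_def
  by (intro Hausdorff_space_subtopology) (simp add: Hausdorff_space_product_topology)

section \<open>Locality and continuity\<close>

lemma local_on_uniform:
  assumes "local_on X F"
  shows "\<exists>N. \<forall>x\<in>X. \<forall>y\<in>X. agree N x y \<longrightarrow> agree M (F x) (F y)"
proof -
  obtain N where N: "\<And>j x y. x \<in> X \<Longrightarrow> y \<in> X \<Longrightarrow> agree (N j) x y \<Longrightarrow> F x j = F y j"
    using assms unfolding local_on_def by metis
  define K where "K = Max (N ` {- int M..int M})"
  have "N j \<le> K" if "\<bar>j\<bar> \<le> int M" for j
    using that unfolding K_def by (intro Max_ge imageI) auto
  then have "agree M (F x) (F y)" if "x \<in> X" "y \<in> X" "agree K x y" for x y
    unfolding agree_def using that by (meson N agree_mono)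
  then show ?thesis by blast
qed

lemma local_on_compose:
  assumes "local_on X F" "local_on Y G" "\<And>x. x \<in> X \<Longrightarrow> F x \<in> Y"
  shows "local_on X (\<lambda>x. G (F x))"
  unfolding local_on_def
proof
  fix j
  obtain M where M: "\<And>x y. x \<in> Y \<Longrightarrow> y \<in> Y \<Longrightarrow> agree M x y \<Longrightarrow> G x j = G y j"
    using assms(2) unfolding local_on_def by metis
  show "\<exists>N. \<forall>x\<in>X. \<forall>y\<in>X. agree N x y \<longrightarrow> G (F x) j = G (F y) j"
    using local_on_uniform[OF assms(1), of M] M assms(3) by metis
qed

lemma local_on_shift: "local_on X (shift k)"
  unfolding local_on_def
proof
  fix j
  show "\<exists>N. \<forall>x\<in>X. \<forall>y\<in>X. agree N x y \<longrightarrow> shift k x j = shift k y j"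
    by (rule exI[of _ "nat \<bar>j + k\<bar>"]) (auto simp: agree_def)
qed

lemma local_on_seq_subst: "local_on X (seq_subst \<alpha>)"
  unfolding local_on_def
proof
  fix j
  show "\<exists>N. \<forall>x\<in>X. \<forall>y\<in>X. agree N x y \<longrightarrow> seq_subst \<alpha> x j = seq_subst \<alpha> y j"
    by (rule exI[of _ "nat \<bar>j div 2\<bar>"]) (auto simp: agree_def seq_subst_def)
qed

text \<open>Continuity gives each point its own window for coordinate \<open>j\<close>; compactness
  makes one window serve all points.\<close>

lemma curtis_hedlund_lyndon:
  assumes "finite A"
  shows "continuous_map (subst_top A \<alpha>) (subst_top B \<gamma>) F \<longleftrightarrow>
    F \<in> subst_shift A \<alpha> \<rightarrow> subst_shift B \<gamma> \<and> local_on (subst_shift A \<alpha>) F" (is "?L \<longleftrightarrow> ?R")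
proof
  assume R: ?R
  show ?L unfolding continuous_map_def
  proof (intro conjI allI impI)
    fix U assume U: "openin (subst_top B \<gamma>) U"
    show "openin (subst_top A \<alpha>) {x \<in> topspace (subst_top A \<alpha>). F x \<in> U}"
      unfolding openin_subst_top_iff
    proof (intro conjI ballI)
      fix x assume x: "x \<in> {x \<in> topspace (subst_top A \<alpha>). F x \<in> U}"
      then obtain M where M: "\<And>y. y \<in> subst_shift B \<gamma> \<Longrightarrow> agree M (F x) y \<Longrightarrow> y \<in> U"
        using U unfolding openin_subst_top_iff by blast
      obtain N where "\<And>x y. x \<in> subst_shift A \<alpha> \<Longrightarrow> y \<in> subst_shift A \<alpha> \<Longrightarrow> agree N x y \<Longrightarrow> agree M (F x) (F y)"
        using local_on_uniform R by metis
      then show "\<exists>N. \<forall>y\<in>subst_shift A \<alpha>. agree N x y \<longrightarrow> y \<in> {x \<in> topspace (subst_top A \<alpha>). F x \<in> U}"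
        using x M R unfolding topspace_subst_top by blast
    qed auto
  qed (use R in auto)
next
  assume L: ?L
  have F: "F \<in> subst_shift A \<alpha> \<rightarrow> subst_shift B \<gamma>"
    using L by (auto simp: continuous_map_def)
  have "\<exists>N. \<forall>x\<in>subst_shift A \<alpha>. \<forall>y\<in>subst_shift A \<alpha>. agree N x y \<longrightarrow> F x j = F y j" for j
  proof -
    \<comment> \<open>The points at which a window of radius \<open>N\<close> already determines
      coordinate \<open>j\<close> of the image. These sets are open and, by continuity, cover the
      shift.\<close>
    define U where "U N = {x \<in> subst_shift A \<alpha>. \<forall>y\<in>subst_shift A \<alpha>. agree N x y \<longrightarrow> F y j = F x j}" for N
    have "openin (subst_top A \<alpha>) (U N)" for N
      unfolding openin_subst_top_iff
    proof (intro conjI ballI)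
      fix x assume x: "x \<in> U N"
      have "y \<in> U N" if y: "y \<in> subst_shift A \<alpha>" "agree N x y" for y
      proof -
        have "F w j = F y j" if "w \<in> subst_shift A \<alpha>" "agree N y w" for w
        proof -
          have "F w j = F x j" "F y j = F x j"
            using x y(1,2) that(1) agree_trans[OF y(2) that(2)] unfolding U_def mem_Collect_eq by blast+
          then show ?thesis by simp
        qed
        then show ?thesis using y(1) unfolding U_def mem_Collect_eq by metis
      qed
      then show "\<exists>N'. \<forall>y\<in>subst_shift A \<alpha>. agree N' x y \<longrightarrow> y \<in> U N" by blast
    qed (simp add: U_def)
    moreover have "topspace (subst_top A \<alpha>) \<subseteq> \<Union> (range U)"
    proof
      fix x assume "x \<in> topspace (subst_top A \<alpha>)"
      then have x: "x \<in> subst_shift A \<alpha>" by simp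
      define V where "V = {y \<in> subst_shift B \<gamma>. y j = F x j}"
      have "openin (subst_top B \<gamma>) V" unfolding openin_subst_top_iff
      proof (intro conjI ballI)
        fix y assume y: "y \<in> V"
        have "y j = w j" if "agree (nat \<bar>j\<bar>) y w" for w
          using that by (simp add: agree_def)
        then show "\<exists>N. \<forall>w\<in>subst_shift B \<gamma>. agree N y w \<longrightarrow> w \<in> V"
          using y unfolding V_def mem_Collect_eq by metis
      qed (auto simp: V_def)
      then have "openin (subst_top A \<alpha>) {y \<in> topspace (subst_top A \<alpha>). F y \<in> V}"
        using L by (auto simp: continuous_map_def)
      moreover have "x \<in> {y \<in> topspace (subst_top A \<alpha>). F y \<in> V}"
        using x F by (auto simp: V_def)
      ultimately obtain N where "\<forall>y\<in>subst_shift A \<alpha>. agree N x y \<longrightarrow> F y \<in> V"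
        unfolding openin_subst_top_iff by blast
      then have "x \<in> U N" using x unfolding U_def V_def mem_Collect_eq by blast
      then show "x \<in> \<Union> (range U)" by blast
    qed
    ultimately have "\<exists>\<F>. finite \<F> \<and> \<F> \<subseteq> range U \<and> topspace (subst_top A \<alpha>) \<subseteq> \<Union> \<F>"
      using compact_space_subst_top[OF assms, of \<alpha>] unfolding compact_space_alt
      by (metis (no_types, lifting) image_iff)
    then obtain J where J: "finite J" "topspace (subst_top A \<alpha>) \<subseteq> \<Union> (U ` J)"
      by (metis finite_subset_image)
    have "F x j = F y j" if xy: "x \<in> subst_shift A \<alpha>" "y \<in> subst_shift A \<alpha>" "agree (Max J) x y" for x y
    proof -
      obtain N where N: "N \<in> J" "x \<in> U N" using J(2) xy(1) by auto
      then have "agree N x y" using xy(3) J(1) by (meson agree_mono Max_ge)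
      then show ?thesis using N(2) xy(2) unfolding U_def mem_Collect_eq by metis
    qed
    then show ?thesis by blast
  qed
  then show ?R using F by (auto simp: local_on_def)
qed

subsection \<open>Endomorphisms of the Toeplitz shift\<close>

declare One_nat_def [simp del]

text \<open>\<open>zseq\<close> has a 1 at every position congruent to 1 modulo 4. A window of
  radius 3 therefore reveals the parity of a desubstitution.\<close>

lemma Xt_one_in_window:
  assumes "x \<in> Xt"
  obtains i where "\<bar>i\<bar> \<le> 3" "x i = 1"
proof -
  obtain c where c: "\<And>i. \<bar>i\<bar> \<le> 3 \<Longrightarrow> x i = zseq (i + c)"
    using assms unfolding Xt_iff by (metis of_nat_numeral)
  define i where "i = (1 - c) mod 4"
  have i: "\<bar>i\<bar> \<le> 3" by (simp add: i_def) 
  have "i + c = 4 * ((i + c) div 4) + 1" unfolding i_def by presburger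
  then have "x i = 1" using c[OF i] zseq_1_mod_4[of "(i + c) div 4"] by simp
  then show ?thesis using that i by blast
qed

lemma T_one_imp_odd: "y \<in> Xt \<Longrightarrow> T y i = 1 \<Longrightarrow> odd i"
  by (metis T_Xt_even evenE zero_neq_one)

text \<open>The symbols 1 of a point occupy positions of one parity only.\<close>

lemma Xt_no_11:
  assumes x: "x \<in> Xt" and "x (i - 1) = 1"
  shows "x i \<noteq> 1"
proof
  assume a: "x i = 1"
  obtain d u where du: "u \<in> Xt" "x = shift d (T u)" using Xt_desubst[OF x] by metis
  then have "T u (i - 1 + d) = 1" "T u (i + d) = 1" using a assms by simp_all
  then have "odd (i - 1 + d)" "odd (i + d)" by (intro T_one_imp_odd[OF du(1)]; simp)+
  then show False by presburger
qed

lemma T_inj: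
  assumes "x \<in> Xt" "y \<in> Xt" "T x = T y"
  shows "x = y"
proof
  fix i
  show "x i = y i"
    using T_Xt_odd[OF assms(1), of i] T_Xt_odd[OF assms(2), of i] assms(3)
      Xt_range[OF assms(1), of i] Xt_range[OF assms(2), of i] by auto
qed

text \<open>Used with \<open>m = 1\<close> for shift-commuting maps and with \<open>m = 2\<close>
  for maps that double shifts.\<close>

lemma intertwines_shift:
  assumes inv: "\<And>x k. x \<in> X \<Longrightarrow> shift k x \<in> X"
    and comm: "\<And>x. x \<in> X \<Longrightarrow> F (shift 1 x) = shift m (F x)" and x: "x \<in> X"
  shows "F (shift k x) = shift (m * k) (F x)"
proof (induction k rule: int_induct[where k = 0])
  case (step1 i)
  have "F (shift (i + 1) x) = F (shift 1 (shift i x))" by (simp only: shift_shift add.commute)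
  also have "\<dots> = shift m (F (shift i x))" by (rule comm[OF inv[OF x]])
  also have "\<dots> = shift (m * (i + 1)) (F x)"
    by (simp only: step1.IH shift_shift ring_distribs mult_1_right add.commute)
  finally show ?case .
next
  case (step2 i)
  have "F (shift i x) = F (shift 1 (shift (i - 1) x))" by (simp only: shift_shift) simp
  also have "\<dots> = shift m (F (shift (i - 1) x))" by (rule comm[OF inv[OF x]])
  finally have "shift (- m) (shift (m * i) (F x)) = shift (- m) (shift m (F (shift (i - 1) x)))"
    by (simp only: step2.IH)
  then have "shift (m * i - m) (F x) = F (shift (i - 1) x)"
    by (simp only: shift_shift add.commute[of "- m"]) simp
  then show ?case by (simp only: right_diff_distrib mult_1_right)
qed simp

text \<open>Each \<open>B x\<close> desubstitutes with some offset; the point is that one offset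
  \<open>e\<close> serves all \<open>x\<close>. Locality compares \<open>B x\<close> with an even
  shift of \<open>B zseq\<close>, and even shifts preserve the parity of the positions of 1.\<close>

lemma desubst_map:
  assumes B: "\<And>x. x \<in> Xt \<Longrightarrow> B x \<in> Xt" and loc: "local_on Xt B"
    and comm: "\<And>x. x \<in> Xt \<Longrightarrow> B (shift 1 x) = shift 2 (B x)"
  obtains e C where "e \<in> {0, 1}" "\<And>x. x \<in> Xt \<Longrightarrow> C x \<in> Xt"
    "\<And>x. x \<in> Xt \<Longrightarrow> B x = shift e (T (C x))"
    "\<And>x. x \<in> Xt \<Longrightarrow> C (shift 1 x) = shift 1 (C x)"
proof -
  obtain e y0 where e: "e \<in> {0, 1}" "y0 \<in> Xt" "B zseq = shift e (T y0)"
    using Xt_desubst[OF B[OF zseq_in_Xt]] by blast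
  have "\<exists>y\<in>Xt. B x = shift e (T y)" if x: "x \<in> Xt" for x
  proof -
    obtain N where N: "\<And>y. y \<in> Xt \<Longrightarrow> agree N x y \<Longrightarrow> agree 3 (B x) (B y)"
      using local_on_uniform[OF loc] x by metis
    obtain c where "agree N x (shift c zseq)"
      using x unfolding Xt_iff agree_def shift_apply by blast
    then have a: "agree 3 (B x) (shift (2 * c) (B zseq))"
      using N shift_in_subst_shift[OF zseq_in_Xt] 
        intertwines_shift[of Xt B 2 zseq, OF shift_in_subst_shift comm zseq_in_Xt] by metis
    obtain d y where d: "d \<in> {0, 1}" "y \<in> Xt" "B x = shift d (T y)"
      using Xt_desubst[OF B[OF x]] by blast
    \<comment> \<open>A 1 in the window where \<open>B x\<close> and the shifted
      \<open>B zseq\<close> agree forces their offsets to be equal modulo 2.\<close>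
    obtain i where i: "\<bar>i\<bar> \<le> 3" "B x i = 1" using Xt_one_in_window[OF B[OF x]] by blast
    then have "odd (i + d)" by (intro T_one_imp_odd[OF d(2)]) (simp add: d(3))
    moreover have "T y0 (i + 2 * c + e) = 1"
      using a i unfolding agree_def by (simp add: e(3) add.assoc)
    then have "odd (i + 2 * c + e)" using T_one_imp_odd e(2) by blast
    ultimately have "d = e" using d(1) e(1) by auto
    then show ?thesis using d by blast
  qed
  then obtain C where C: "\<And>x. x \<in> Xt \<Longrightarrow> C x \<in> Xt" "\<And>x. x \<in> Xt \<Longrightarrow> B x = shift e (T (C x))"
    by metis
  have "C (shift 1 x) = shift 1 (C x)" if x: "x \<in> Xt" for x
  proof (rule T_inj)
    have sx: "shift 1 x \<in> Xt" by (rule shift_in_subst_shift[OF x])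
    have "shift e (T (C (shift 1 x))) = shift e (T (shift 1 (C x)))"
      using comm[OF x] unfolding C(2)[OF x] C(2)[OF sx] seq_subst_shift by (simp add: add.commute)
    from arg_cong[OF this, of "shift (- e)"] show "T (C (shift 1 x)) = T (shift 1 (C x))" by simp
  qed (intro C(1) shift_in_subst_shift x)+
  then show ?thesis using that e(1) C by blast
qed

lemma window_at:
  assumes inv: "\<And>x k. x \<in> X \<Longrightarrow> shift k x \<in> X"
    and comm: "\<And>x. x \<in> X \<Longrightarrow> F (shift 1 x) = shift 1 (F x)"
    and win: "\<And>x y. x \<in> X \<Longrightarrow> y \<in> X \<Longrightarrow> (\<forall>i\<in>{a..b}. x i = y i) \<Longrightarrow> F x 0 = F y 0"
    and xy: "x \<in> X" "y \<in> X" "\<forall>i\<in>{a + j..b + j}. x i = y i"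
  shows "F x j = F y j"
proof -
  have F: "F z j = F (shift j z) 0" if "z \<in> X" for z
    using intertwines_shift[of X F 1, OF inv comm that, of j] by simp
  have "F (shift j x) 0 = F (shift j y) 0"
    by (rule win) (use xy inv in auto)
  then show ?thesis by (simp add: F xy(1,2))
qed

text \<open>Desubstituting \<open>C \<circ> T\<close> yields an endomorphism \<open>D\<close> whose window is about half as wide
  as that of \<open>C\<close>. For a window of width one, \<open>C\<close> is a shift because two consecutive
  \<open>1\<close>s and long runs of \<open>0\<close>s are both forbidden.\<close>

lemma endomorphism_with_window_is_shift:
  assumes "\<And>x. x \<in> Xt \<Longrightarrow> C x \<in> Xt" "\<And>x. x \<in> Xt \<Longrightarrow> C (shift 1 x) = shift 1 (C x)" "a \<le> b"
    "\<And>x y. x \<in> Xt \<Longrightarrow> y \<in> Xt \<Longrightarrow> (\<forall>i\<in>{a..b}. x i = y i) \<Longrightarrow> C x 0 = C y 0"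
  shows "\<exists>k. \<forall>x\<in>Xt. C x = shift k x"
  using assms
proof (induction "nat (b - a)" arbitrary: a b C rule: less_induct)
  case less
  note C = less.prems(1) and comm = less.prems(2) and ab = less.prems(3)
  have win: "C x j = C y j"
    if "x \<in> Xt" "y \<in> Xt" "\<And>i. a + j \<le> i \<Longrightarrow> i \<le> b + j \<Longrightarrow> x i = y i" for x y j
    by (rule window_at[of Xt C a b, OF shift_in_subst_shift comm less.prems(4)]) (use that in auto)
  show ?case
  proof (cases "a = b")
    case True
    have same: "C x i = C y j" if "x \<in> Xt" "y \<in> Xt" "x (i + a) = y (j + a)" for x y i j
    proof -
      have C0: "C z l = C (shift l z) 0" if "z \<in> Xt" for z l
        using intertwines_shift[of Xt C 1, OF shift_in_subst_shift comm that, of l] by simp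
      have "C (shift i x) 0 = C (shift j y) 0"
        by (rule less.prems(4)) (use that True shift_in_subst_shift in \<open>auto simp: add.commute\<close>)
      then show ?thesis by (simp add: C0[OF that(1)] C0[OF that(2)])
    qed
    note zz = zseq_in_Xt
    have Cz: "C zseq \<in> Xt" by (rule C[OF zz])
    \<comment> \<open>\<open>zseq\<close> has 00 at positions 2 and 3, so if the one-block map sent
      0 to 1, the image would contain 11.\<close>
    have ne: "C zseq (2 - a) = 0"
      using Xt_range[OF Cz, of "2 - a"] same[OF zz zz, of "2 - a" "3 - a"] Xt_no_11[OF Cz, of "3 - a"]
      by (auto simp: algebra_simps)
    \<comment> \<open>If 1 were sent to 0 as well, the image of \<open>zseq\<close> would contain no
      1 at all.\<close>
    have one: "C zseq (1 - a) = 1"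
    proof (rule ccontr)
      assume "C zseq (1 - a) \<noteq> 1"
      then have o: "C zseq (1 - a) = 0" using Xt_range[OF Cz] by metis
      obtain i where i: "C zseq i = 1" using Xt_one_in_window[OF Cz] by metis
      consider "zseq (i + a) = 0" | "zseq (i + a) = 1" using Xt_range[OF zz] by metis
      then show False
      proof cases
        case 1
        then show False using same[OF zz zz, of i "2 - a"] ne i by simp
      next
        case 2
        then show False using same[OF zz zz, of i "1 - a"] o i by simp
      qed
    qed
    have "C x i = x (i + a)" if x: "x \<in> Xt" for x i
      using Xt_range[OF x, of "i + a"] same[OF x zz, of i "2 - a"] same[OF x zz, of i "1 - a"] ne one
      by auto
    then show ?thesis by (intro exI[of _ a]) (auto simp: fun_eq_iff)
  next
    case False
    have locC: "local_on Xt C" unfolding local_on_def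
    proof
      fix j
      have "C x j = C y j" if "x \<in> Xt" "y \<in> Xt" "agree (nat (\<bar>a + j\<bar> + \<bar>b + j\<bar>)) x y" for x y
        using that by (intro win) (auto simp: agree_def)
      then show "\<exists>N. \<forall>x\<in>Xt. \<forall>y\<in>Xt. agree N x y \<longrightarrow> C x j = C y j" by blast
    qed
    have CT: "C (T (shift 1 x)) = shift 2 (C (T x))" if "x \<in> Xt" for x
      using intertwines_shift[of Xt C 1, OF shift_in_subst_shift comm T_in_Xt[OF that], of 2]
      by (simp add: seq_subst_shift)
    obtain e D where e: "e \<in> {0, 1}" and D: "\<And>x. x \<in> Xt \<Longrightarrow> D x \<in> Xt"
      and CD: "\<And>x. x \<in> Xt \<Longrightarrow> C (T x) = shift e (T (D x))"
      and Dcomm: "\<And>x. x \<in> Xt \<Longrightarrow> D (shift 1 x) = shift 1 (D x)"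
      using desubst_map[of "\<lambda>x. C (T x)", OF C[OF T_in_Xt]
          local_on_compose[OF local_on_seq_subst locC T_in_Xt] CT] by blast
    \<comment> \<open>\<open>a'\<close> and \<open>b'\<close> bound the \<open>k\<close> for which
      \<open>2 * k + 1\<close> lies between \<open>a + (1 - e)\<close> and
      \<open>b + (1 - e)\<close>; even positions of \<open>T x\<close> carry no information.\<close>
    define a' where "a' = (a - e + 1) div 2"
    define b' where "b' = (b - e) div 2"
    have "a' \<le> b'" "b' - a' < b - a"
      using ab False unfolding a'_def b'_def by presburger+
    then have ab': "a' \<le> b'" "nat (b' - a') < nat (b - a)" by simp_all
    have Dwin: "D x 0 = D y 0" if xy: "x \<in> Xt" "y \<in> Xt" "\<forall>i\<in>{a'..b'}. x i = y i" for x y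
    proof -
      have "T x i = T y i" if i: "a + (1 - e) \<le> i" "i \<le> b + (1 - e)" for i
      proof (cases "even i")
        case True
        then show ?thesis using T_Xt_even xy by (metis evenE)
      next
        case False
        then obtain k where k: "i = 2 * k + 1" by (elim oddE)
        have "k \<in> {a'..b'}" using i unfolding a'_def b'_def k by auto
        then show ?thesis using xy(3) by (simp only: k T_Xt_odd[OF xy(1)] T_Xt_odd[OF xy(2)])
      qed
      \<comment> \<open>Coordinate \<open>1 - e\<close> of \<open>C (T x)\<close> is coordinate 1 of
        \<open>T (D x)\<close>, that is \<open>1 - D x 0\<close>.\<close>
      then have "C (T x) (1 - e) = C (T y) (1 - e)"
        by (intro win T_in_Xt xy) auto
      then have "T (D x) (2 * 0 + 1) = T (D y) (2 * 0 + 1)"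
        by (simp add: CD xy(1,2))
      then show ?thesis
        unfolding T_Xt_odd[OF D[OF xy(1)]] T_Xt_odd[OF D[OF xy(2)]]
        using Xt_range[OF D[OF xy(1)], of 0] Xt_range[OF D[OF xy(2)], of 0] by auto
    qed
    obtain k where k: "\<And>x. x \<in> Xt \<Longrightarrow> D x = shift k x"
      using less.hyps[of b' a' D, OF ab'(2) D Dcomm ab'(1) Dwin] by blast
    \<comment> \<open>Every point is a shift of some \<open>T y\<close>, so \<open>C\<close> is
      known once it is known on the image of \<open>T\<close>.\<close>
    have "C x = shift (e + 2 * k) x" if x: "x \<in> Xt" for x
    proof -
      obtain d y where dy: "y \<in> Xt" "x = shift d (T y)" using Xt_desubst[OF x] by metis
      have "C x = shift d (C (T y))"
        using intertwines_shift[of Xt C 1, OF shift_in_subst_shift comm T_in_Xt[OF dy(1)], of d] dy(2) by simp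
      also have "\<dots> = shift (e + 2 * k) x"
        by (simp add: CD[OF dy(1)] k[OF dy(1)] seq_subst_shift dy(2) algebra_simps)
      finally show ?thesis .
    qed
    then show ?thesis by blast
  qed
qed

lemma endomorphism_is_shift:
  assumes "\<And>x. x \<in> Xt \<Longrightarrow> C x \<in> Xt" "\<And>x. x \<in> Xt \<Longrightarrow> C (shift 1 x) = shift 1 (C x)"
    "local_on Xt C"
  obtains k where "\<And>x. x \<in> Xt \<Longrightarrow> C x = shift k x"
proof -
  obtain N where N: "\<And>x y. x \<in> Xt \<Longrightarrow> y \<in> Xt \<Longrightarrow> agree N x y \<Longrightarrow> C x 0 = C y 0"
    using assms(3) unfolding local_on_def by metis
  have win: "C x 0 = C y 0" if "x \<in> Xt" "y \<in> Xt" "\<forall>i\<in>{- int N..int N}. x i = y i" for x y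
  proof (rule N[OF that(1,2)])
    show "agree N x y" using that(3) unfolding agree_def by (simp add: abs_le_iff)
  qed
  have "\<exists>k. \<forall>x\<in>Xt. C x = shift k x"
    by (rule endomorphism_with_window_is_shift[of C "- int N" "int N", OF assms(1,2) _ win]) simp_all
  then show ?thesis using that by blast
qed

subsection \<open>Substitutions conjugate to the Toeplitz substitution\<close>

text \<open>Transported to X, \<open>\<beta>\<close> becomes a shift-doubling map, hence a shift of
  \<open>T\<close> because endomorphisms are shifts. The remaining offset is absorbed into the
  conjugacy.\<close>

lemma conjugacy_intertwining_substitutions:
  assumes "in_toeplitz_class A \<beta>"
  obtains g where "\<And>x. x \<in> Xt \<Longrightarrow> g x \<in> subst_shift A \<beta>"
    "\<And>x. x \<in> Xt \<Longrightarrow> g (shift 1 x) = shift 1 (g x)" "local_on Xt g"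
    "\<And>x. x \<in> Xt \<Longrightarrow> seq_subst \<beta> (g x) = g (T x)"
proof -
  let ?Y = "subst_shift A \<beta>"
  interpret two_subst A \<beta>
    using assms by unfold_locales (auto simp: in_toeplitz_class_def)
  have fin: "finite A" using assms by (simp add: in_toeplitz_class_def alphabet_def)
  obtain h where h: "homeomorphic_map (subst_top A \<beta>) (subst_top {0, 1} tau) h"
    "\<And>y. y \<in> ?Y \<Longrightarrow> h (shift 1 y) = shift 1 (h y)"
    using assms by (auto simp: in_toeplitz_class_def topologically_conjugate_def left_shift_eq_shift)
  then obtain g where "homeomorphic_maps (subst_top A \<beta>) (subst_top {0, 1} tau) h g"
    by (auto simp: homeomorphic_map_maps)
  then have hg: "h \<in> ?Y \<rightarrow> Xt" "local_on ?Y h" "g \<in> Xt \<rightarrow> ?Y" "local_on Xt g"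
    "\<And>y. y \<in> ?Y \<Longrightarrow> g (h y) = y" "\<And>x. x \<in> Xt \<Longrightarrow> h (g x) = x"
    using fin by (auto simp: homeomorphic_maps_def curtis_hedlund_lyndon)
  have gX: "g x \<in> ?Y" if "x \<in> Xt" for x using hg(3) that by auto
  have hY: "h y \<in> Xt" if "y \<in> ?Y" for y using hg(1) that by auto
  note Xs = shift_in_subst_shift[of _ "{0, 1}" tau]
  note Ys = shift_in_subst_shift[of _ A \<beta>]
  have gs: "g (shift 1 x) = shift 1 (g x)" if "x \<in> Xt" for x
  proof -
    have "h (shift 1 (g x)) = shift 1 x" using h(2)[OF gX[OF that]] hg(6)[OF that] by simp
    then show ?thesis using hg(5)[OF Ys[OF gX[OF that]], of 1] by simp
  qed
  define B where "B x = h (seq_subst \<beta> (g x))" for x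
  have BX: "B x \<in> Xt" if "x \<in> Xt" for x
    unfolding B_def by (intro hY seq_subst_shift_in gX that)
  have Bl: "local_on Xt B" unfolding B_def
    by (rule local_on_compose[OF hg(4) local_on_compose[OF local_on_seq_subst hg(2) seq_subst_shift_in] gX])
  have Bs: "B (shift 1 x) = shift 2 (B x)" if "x \<in> Xt" for x
  proof -
    have "B (shift 1 x) = h (shift 2 (seq_subst \<beta> (g x)))"
      by (simp add: B_def gs[OF that] seq_subst_shift)
    also have "\<dots> = shift (1 * 2) (B x)"
      unfolding B_def by (rule intertwines_shift[of ?Y h 1, OF Ys h(2) seq_subst_shift_in[OF gX[OF that]]])
    finally show ?thesis by simp
  qed
  obtain e C where C: "\<And>x. x \<in> Xt \<Longrightarrow> C x \<in> Xt" "\<And>x. x \<in> Xt \<Longrightarrow> B x = shift e (T (C x))"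
    "\<And>x. x \<in> Xt \<Longrightarrow> C (shift 1 x) = shift 1 (C x)" and e: "e \<in> {0, 1}"
    using desubst_map[of B, OF BX Bl Bs] by metis
  have "local_on Xt C" unfolding local_on_def
  proof
    fix j
    obtain N where N: "\<And>x y. x \<in> Xt \<Longrightarrow> y \<in> Xt \<Longrightarrow> agree N x y \<Longrightarrow> B x (2 * j + 1 - e) = B y (2 * j + 1 - e)"
      using Bl unfolding local_on_def by metis
    \<comment> \<open>\<open>C\<close> inherits locality from \<open>B\<close>, since its coordinate
      \<open>j\<close> is read off an odd coordinate of \<open>T (C x)\<close>.\<close>
    have Cj: "C x j = 1 - B x (2 * j + 1 - e)" if "x \<in> Xt" for x
      using T_Xt_odd[OF C(1)[OF that], of j] Xt_range[OF C(1)[OF that], of j]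
      by (auto simp: C(2)[OF that])
    show "\<exists>N. \<forall>x\<in>Xt. \<forall>y\<in>Xt. agree N x y \<longrightarrow> C x j = C y j"
      using N Cj by metis
  qed
  then obtain k where k: "\<And>x. x \<in> Xt \<Longrightarrow> C x = shift k x"
    using endomorphism_is_shift[of C] C(1,3) by metis
  define m where "m = e + 2 * k"
  have Bm: "B x = shift m (T x)" if "x \<in> Xt" for x
    by (simp add: C(2)[OF that] k[OF that] seq_subst_shift m_def)
  have gsk: "g (shift j x) = shift j (g x)" if "x \<in> Xt" for x j
    using intertwines_shift[of Xt g 1, OF Xs gs that, of j] by simp
  have bg: "seq_subst \<beta> (g x) = shift m (g (T x))" if "x \<in> Xt" for x
  proof -
    have "seq_subst \<beta> (g x) = g (B x)"
      unfolding B_def by (rule hg(5)[symmetric]) (intro seq_subst_shift_in gX that)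
    then show ?thesis by (simp add: Bm[OF that] gsk[OF T_in_Xt[OF that]])
  qed
  \<comment> \<open>Precomposing \<open>g\<close> with a shift by \<open>n\<close> turns \<open>m\<close> into \<open>m + n\<close>, as \<open>\<beta>\<close> and \<open>T\<close> double shifts.\<close>
  define f where "f x = g (shift (- m) x)" for x
  show ?thesis
  proof (rule that[of f])
    show "f x \<in> ?Y" if "x \<in> Xt" for x unfolding f_def by (intro gX Xs that)
    show "f (shift 1 x) = shift 1 (f x)" if "x \<in> Xt" for x
      unfolding f_def by (simp add: gsk[OF that] gsk[OF Xs[OF that]])
    show "local_on Xt f"
      unfolding f_def by (rule local_on_compose[OF local_on_shift hg(4) Xs])
    show "seq_subst \<beta> (f x) = f (T x)" if "x \<in> Xt" for x
      unfolding f_def gsk[OF that] gsk[OF T_in_Xt[OF that]] seq_subst_shift bg[OF that]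
      by simp
  qed
qed

text \<open>\<open>G x 0\<close> is determined by \<open>G (T x)\<close> at \<open>0\<close> and \<open>1\<close>, which roughly halves the window.
  Since \<open>T x\<close> vanishes at even positions, the process ends with \<open>{-1..0}\<close> and not merely with
  \<open>{-1..1}\<close>.\<close>

lemma (in two_subst) window_reduction:
  fixes l r :: nat
  assumes inj: "inj_on \<alpha> A" and G: "\<And>x. x \<in> Xt \<Longrightarrow> G x \<in> UNIV \<rightarrow> A"
    and comm: "\<And>x. x \<in> Xt \<Longrightarrow> G (shift 1 x) = shift 1 (G x)"
    and GT: "\<And>x. x \<in> Xt \<Longrightarrow> seq_subst \<alpha> (G x) = G (T x)"
    and "l \<ge> 1"
    and "\<And>x y. x \<in> Xt \<Longrightarrow> y \<in> Xt \<Longrightarrow> (\<forall>i\<in>{- int l..int r}. x i = y i) \<Longrightarrow> G x 0 = G y 0"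
    and "x \<in> Xt" "y \<in> Xt" "\<forall>i\<in>{-1..0}. x i = y i"
  shows "G x 0 = G y 0"
  using assms(5-)
proof (induction "l + r" arbitrary: l r x y rule: less_induct)
  case less
  show ?case
  proof (cases "l = 1 \<and> r = 0")
    case True
    then show ?thesis using less.prems(2)[OF less.prems(3,4)] less.prems(5) by simp
  next
    case False
    \<comment> \<open>Coordinates 0 and 1 of \<open>G (T x)\<close> see positions \<open>- l\<close>
      to \<open>r + 1\<close> of \<open>T x\<close>; the odd ones among these,
      \<open>2 * k + 1\<close>, have \<open>k\<close> between \<open>- l'\<close> and
      \<open>r'\<close>.\<close>
    define l' where "l' = (l + 1) div 2"
    define r' where "r' = r div 2"
    have lr: "l' + r' < l + r" "l' \<ge> 1" using False less.prems(1) unfolding l'_def r'_def by presburger+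
    have win: "G x 0 = G y 0" if xy: "x \<in> Xt" "y \<in> Xt" "\<forall>i\<in>{- int l'..int r'}. x i = y i" for x y
    proof -
      have "T x i = T y i" if i: "- int l \<le> i" "i \<le> int r + 1" for i
      proof (cases "even i")
        case True
        then show ?thesis using T_Xt_even xy by (metis evenE)
      next
        case False
        then obtain k where k: "i = 2 * k + 1" by (elim oddE)
        have "k \<in> {- int l'..int r'}" using i unfolding l'_def r'_def k by auto
        then show ?thesis using xy(3) by (simp only: k T_Xt_odd[OF xy(1)] T_Xt_odd[OF xy(2)])
      qed
      then have "G (T x) j = G (T y) j" if "j \<in> {0, 1}" for j
        by (intro window_at[of Xt G "- int l" "int r" "T x" "T y" j, OF shift_in_subst_shift comm less.prems(2)]
            T_in_Xt xy) (use that in auto)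
      then have "seq_subst \<alpha> (G x) j = seq_subst \<alpha> (G y) j" if "j \<in> {0, 1}" for j
        using that GT xy by simp
      from this[of 0] this[of 1] have "\<alpha> (G x 0) ! 0 = \<alpha> (G y 0) ! 0" "\<alpha> (G x 0) ! 1 = \<alpha> (G y 0) ! 1"
        by (simp_all add: seq_subst_def One_nat_def)
      moreover have "G x 0 \<in> A" "G y 0 \<in> A" using G xy by blast+
      ultimately show ?thesis using inj_seq_subst[OF inj] by blast
    qed
    show ?thesis by (rule less.hyps[OF lr win less.prems(3-5)])
  qed
qed

lemma length_2_eqI: "length u = 2 \<Longrightarrow> u ! 0 = a \<Longrightarrow> u ! 1 = b \<Longrightarrow> u = [a, b]"
  by (rule nth_equalityI) (auto simp: less_2_cases_iff One_nat_def)

text \<open>The letters may coincide here. The table results from reading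
  \<open>\<beta> (g x) = g (T x)\<close> along \<open>zseq\<close>, once \<open>g\<close> is known
  to be a code with window from -1 to 0.\<close>

lemma toeplitz_class_table:
  assumes "in_toeplitz_class A \<beta>"
  obtains p q r where "A = {p, q, r}" "\<beta> p = [r, q]" "\<beta> q = [r, p]" "\<beta> r = [q, p]"
proof -
  let ?Y = "subst_shift A \<beta>"
  interpret two_subst A \<beta>
    using assms by unfold_locales (auto simp: in_toeplitz_class_def)
  have inj: "inj_on \<beta> A" and prim: "primitive_subst A \<beta>"
    using assms by (auto simp: in_toeplitz_class_def)
  obtain g where g: "\<And>x. x \<in> Xt \<Longrightarrow> g x \<in> ?Y"
    "\<And>x. x \<in> Xt \<Longrightarrow> g (shift 1 x) = shift 1 (g x)" "local_on Xt g"
    "\<And>x. x \<in> Xt \<Longrightarrow> seq_subst \<beta> (g x) = g (T x)"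
    using conjugacy_intertwining_substitutions[OF assms] by blast
  have gA: "g x \<in> UNIV \<rightarrow> A" if "x \<in> Xt" for x
    using g(1)[OF that] subst_shift_subset by blast
  obtain N where N: "\<And>x y. x \<in> Xt \<Longrightarrow> y \<in> Xt \<Longrightarrow> agree N x y \<Longrightarrow> g x 0 = g y 0"
    using g(3) unfolding local_on_def by metis
  have N': "g x 0 = g y 0" if "x \<in> Xt" "y \<in> Xt" "\<forall>i\<in>{- int (Suc N)..int (Suc N)}. x i = y i" for x y
  proof (rule N[OF that(1,2)])
    show "agree N x y" using that(3) unfolding agree_def by (simp add: abs_le_iff)
  qed
  have win: "g x 0 = g y 0" if "x \<in> Xt" "y \<in> Xt" "\<forall>i\<in>{-1..0}. x i = y i" for x y
    by (rule window_reduction[of g "Suc N" "Suc N", OF inj gA g(2,4) _ N' that]) simp_all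
  have loc: "g x i = g y j" if "x \<in> Xt" "y \<in> Xt" "x (i - 1) = y (j - 1)" "x i = y j" for x y i j
  proof -
    have *: "g z l = g (shift l z) 0" if "z \<in> Xt" for z l
      using intertwines_shift[of Xt g 1, OF shift_in_subst_shift g(2) that, of l] by simp
    have "{-1..0::int} = {-1, 0}" by auto
    then have "g (shift i x) 0 = g (shift j y) 0"
      using that by (intro win shift_in_subst_shift) (auto simp: algebra_simps)
    then show ?thesis by (simp add: *[OF that(1)] *[OF that(2)])
  qed
  note z = zseq_in_Xt
  \<comment> \<open>The words of \<open>zseq\<close> ending at positions 1, 3 and 2 are 01, 00 and
    10.\<close>
  define p q r where "p = g zseq 1" and "q = g zseq 3" and "r = g zseq 2"
  have gp: "g x i = p" if "x \<in> Xt" "x (i - 1) = 0" "x i = 1" for x i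
    unfolding p_def by (rule loc[OF that(1) z]) (simp_all add: that)
  have gq: "g x i = q" if "x \<in> Xt" "x (i - 1) = 0" "x i = 0" for x i
    unfolding q_def by (rule loc[OF that(1) z]) (simp_all add: that)
  have gr: "g x i = r" if "x \<in> Xt" "x (i - 1) = 1" "x i = 0" for x i
    unfolding r_def by (rule loc[OF that(1) z]) (simp_all add: that)
  have gpqr: "g x i \<in> {p, q, r}" if x: "x \<in> Xt" for x i
  proof -
    show ?thesis
      using gp[OF x, of i] gq[OF x, of i] gr[OF x, of i] Xt_range[OF x, of i] Xt_range[OF x, of "i - 1"]
        Xt_no_11[OF x, of i]
      by auto
  qed
  have sub: "\<beta> (g zseq i) = [g (T zseq) (2 * i), g (T zseq) (2 * i + 1)]" for i
  proof -
    have "g zseq i \<in> A" using gA[OF z] by blast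
    then have "length (\<beta> (g zseq i)) = 2" using len by (auto simp: constant_length_def)
    then show ?thesis unfolding g(4)[OF z, symmetric]
      by (intro length_2_eqI) (simp_all add: seq_subst_def One_nat_def)
  qed
  note Tz = T_in_Xt[OF z]
  have z4: "zseq 4 = 0" "zseq 5 = 1" "zseq 6 = 0" "zseq 7 = 1"
    using zseq_even[of 2] zseq_odd[of 2] zseq_even[of 3] zseq_odd[of 3] by simp_all
  \<comment> \<open>\<open>T zseq\<close> reads 1, 0, 0 at positions 1 to 3; the other two entries
    come from positions 5 to 7 and 3 to 5.\<close>
  have "\<beta> p = [r, q]" using sub[of 1] gr[OF Tz, of 2] gq[OF Tz, of 3]
    by (simp add: p_def[symmetric] T_zseq)
  moreover have "\<beta> q = [r, p]" using sub[of 3] gr[OF Tz, of 6] gp[OF Tz, of 7]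
    by (simp add: q_def[symmetric] T_zseq z4)
  moreover have "\<beta> r = [q, p]" using sub[of 2] gq[OF Tz, of 4] gp[OF Tz, of 5]
    by (simp add: r_def[symmetric] T_zseq z4)
  moreover have "A = {p, q, r}"
  proof
    show "{p, q, r} \<subseteq> A" using gA[OF z] by (auto simp: p_def q_def r_def)
    obtain n where n: "\<And>a. a \<in> A \<Longrightarrow> A \<subseteq> set (subst_iter \<beta> n a)"
      using prim by (auto simp: primitive_subst_def)
    \<comment> \<open>By primitivity some iterate of \<open>g zseq 0\<close> contains all of
      \<open>A\<close>, and by the intertwining it is a window of a point in the image of
      \<open>g\<close>.\<close>
    have "(seq_subst \<beta> ^^ n) (g zseq) = g ((T ^^ n) zseq)"
    proof (induction n)
      case (Suc n)
      then show ?case using g(4)[OF tau.funpow_seq_subst_shift_in[OF z, of n]] by simp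
    qed simp
    moreover have "subst_iter \<beta> n (g zseq 0) = factor_at ((seq_subst \<beta> ^^ n) (g zseq)) (2 ^ n * 0) (2 ^ n)"
      using factor_at_funpow_seq_subst[OF gA[OF z], of n 0] by simp
    ultimately have "set (subst_iter \<beta> n (g zseq 0)) \<subseteq> {p, q, r}"
      using gpqr[OF tau.funpow_seq_subst_shift_in[OF z, of n]] by (auto simp: factor_at_def)
    moreover have "g zseq 0 \<in> A" using gA[OF z] by blast
    ultimately show "A \<subseteq> {p, q, r}" using n by blast
  qed
  ultimately show ?thesis using that by blast
qed

lemma toeplitz_class_cases:
  assumes "in_toeplitz_class A \<beta>"
  shows "same_up_to_renaming {1, 2} toeplitz A \<beta> \<or> same_up_to_renaming {1, 2} rotated_toeplitz A \<beta>
    \<or> same_up_to_renaming {1, 2, 3} toeplitz3 A \<beta>"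
proof -
  obtain p q r where A: "A = {p, q, r}" and b: "\<beta> p = [r, q]" "\<beta> q = [r, p]" "\<beta> r = [q, p]"
    using toeplitz_class_table[OF assms] by blast
  have card: "2 \<le> card A" using assms by (simp add: in_toeplitz_class_def alphabet_def)
  have pr: "p \<noteq> r"
  proof
    assume "p = r"
    \<comment> \<open>Compare \<open>\<beta> p = [r, q]\<close> with
      \<open>\<beta> r = [q, p]\<close>: all three letters coincide.\<close>
    then have "p = q" using b(1,3) by (metis list.inject)
    then show False using \<open>p = r\<close> card A by simp
  qed
  consider "q = r" | "p = q" | "q \<noteq> r" "p \<noteq> q" by blast
  then show ?thesis
  proof cases
    case 1
    then have "A = {p, q}" "\<beta> p = [q, q]" "\<beta> q = [q, p]" "p \<noteq> q" using A b pr by auto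
    then have "same_up_to_renaming {1, 2} toeplitz A \<beta>"
      unfolding same_up_to_renaming_def
      by (intro exI[of _ "\<lambda>n. if n = 1 then q else p"]) (auto simp: toeplitz_def bij_betw_def)
    then show ?thesis by blast
  next
    case 2
    then have "A = {q, r}" "\<beta> q = [r, q]" "\<beta> r = [q, q]" "q \<noteq> r" using A b pr by auto
    then have "same_up_to_renaming {1, 2} rotated_toeplitz A \<beta>"
      unfolding same_up_to_renaming_def
      by (intro exI[of _ "\<lambda>n. if n = 1 then q else r"]) (auto simp: rotated_toeplitz_def bij_betw_def)
    then show ?thesis by blast
  next
    case 3
    then have "same_up_to_renaming {1, 2, 3} toeplitz3 A \<beta>"
      unfolding same_up_to_renaming_def using A b pr
      by (intro exI[of _ "\<lambda>n. if n = 1 then r else if n = 2 then q else p"])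
        (auto simp: toeplitz3_def bij_betw_def)
    then show ?thesis by blast
  qed
qed

subsection \<open>Two-block codes of the Toeplitz shift\<close>

text \<open>On X, where 11 does not occur, \<open>p\<close>, \<open>q\<close> and \<open>r\<close>
  code the words 01, 00 and 10 ending at \<open>i\<close>.\<close>

definition block_code :: "'a \<Rightarrow> 'a \<Rightarrow> 'a \<Rightarrow> (int \<Rightarrow> nat) \<Rightarrow> int \<Rightarrow> 'a" where
  "block_code p q r x = (\<lambda>i. if x i = 1 then p else if x (i - 1) = 1 then r else q)"

lemma block_code_shift: "block_code p q r (shift k x) = shift k (block_code p q r x)"
  by (rule ext) (simp add: block_code_def algebra_simps)

lemma block_code_cong:
  "x i = y j \<Longrightarrow> x (i - 1) = y (j - 1) \<Longrightarrow> block_code p q r x i = block_code p q r y j"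
  by (simp add: block_code_def)

text \<open>If \<open>p\<close> is distinct from the other letters, it marks each 1 on the spot. If
  \<open>r\<close> is, it marks each 1 one place to the right, because a 1 is always followed by
  0.\<close>

lemma inj_on_block_code:
  assumes "p \<notin> {q, r} \<or> r \<notin> {p, q}"
  shows "inj_on (block_code p q r) Xt"
proof (rule inj_onI)
  fix x y assume xy: "x \<in> Xt" "y \<in> Xt" "block_code p q r x = block_code p q r y"
  have "x i = 1 \<longleftrightarrow> y i = 1" for i
  proof (cases "p \<in> {q, r}")
    case False
    then have "z i = 1 \<longleftrightarrow> block_code p q r z i = p" for z :: "int \<Rightarrow> nat"
      by (auto simp: block_code_def)
    then show ?thesis using xy(3) by metis
  next
    case True
    then have "z i = 1 \<longleftrightarrow> block_code p q r z (i + 1) = r" if "z \<in> Xt" for z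
      using Xt_no_11[OF that, of "i + 1"] assms by (auto simp: block_code_def)
    then show ?thesis using xy by metis
  qed
  then show "x = y" using Xt_range[OF xy(1)] Xt_range[OF xy(2)] by (metis ext)
qed

text \<open>The table says exactly that the block code intertwines \<open>T\<close> with
  \<open>\<alpha>\<close>. Hence the code maps X into the shift of \<open>\<alpha>\<close>, with
  image dense by the language and closed by compactness; injectivity completes the
  conjugacy.\<close>

lemma topologically_conjugate_tau:
  assumes A: "A = {p, q, r}" and tab: "\<alpha> p = [r, q]" "\<alpha> q = [r, p]" "\<alpha> r = [q, p]"
    and ne: "p \<notin> {q, r} \<or> r \<notin> {p, q}"
  shows "topologically_conjugate (subst_top A \<alpha>) left_shift (subst_top {0, 1} tau) left_shift"
proof -
  interpret two_subst A \<alpha>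
    by unfold_locales (auto simp: A tab constant_length_def substitution_on_def)
  let ?Y = "subst_shift A \<alpha>"
  define F where "F = block_code p q r"
  have FA: "F x \<in> UNIV \<rightarrow> A" for x by (auto simp: F_def block_code_def A)
  have FT: "seq_subst \<alpha> (F x) = F (T x)" if x: "x \<in> Xt" for x
  proof
    fix i :: int
    obtain k where k: "i = 2 * k \<or> i = 2 * k + 1" by (metis oddE evenE)
    have p: "T x (2 * k - 1) = 1 - x (k - 1)" using T_Xt_odd[OF x, of "k - 1"] by simp
    have t: "T x (2 * k) = 0" "T x (2 * k + 1) = 1 - x k" by (rule T_Xt_even[OF x], rule T_Xt_odd[OF x])
    consider "x k = 1" "x (k - 1) = 0" | "x k = 0" "x (k - 1) = 1" | "x k = 0" "x (k - 1) = 0"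
      using Xt_range[OF x] Xt_no_11[OF x, of k] by metis
    then have "\<alpha> (F x k) = [F (T x) (2 * k), F (T x) (2 * k + 1)]"
      by cases (simp_all add: F_def block_code_def tab t p)
    then show "seq_subst \<alpha> (F x) i = F (T x) i"
      using k unfolding seq_subst_def[of \<alpha>] by (elim disjE) simp_all
  qed
  have FTm: "(seq_subst \<alpha> ^^ m) (F x) = F ((T ^^ m) x)" if x: "x \<in> Xt" for x m
    by (induction m) (simp_all add: FT[OF tau.funpow_seq_subst_shift_in[OF x]])
  note z = zseq_in_Xt
  have iter: "subst_iter \<alpha> m (F zseq c) = factor_at (F ((T ^^ m) zseq)) (2 ^ m * c) (2 ^ m)" for m c
    using factor_at_funpow_seq_subst[OF FA] by (simp only: FTm[OF z, symmetric])
  have lang: "factor_at (F zseq) j n \<in> subst_language A \<alpha>" if "j \<ge> 0" for j n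
  proof -
    define m where "m = nat j + n + 1"
    have "j + int n \<le> int m" using that by (simp add: m_def)
    also have "m \<le> 2 ^ (2 * m)" by (rule order.trans[OF _ less_imp_le[OF less_exp]]) simp
    then have "int m \<le> int (2 ^ (2 * m))" by (simp only: of_nat_le_iff)
    finally have "sublist (factor_at (F zseq) j n) (factor_at (F zseq) (2 ^ (2*m) * 0) (2 ^ (2*m)))"
      using that by (intro sublist_factor_at) auto
    also have "\<dots> = subst_iter \<alpha> (2 * m) (F zseq 0)" using iter[of "2 * m" 0] by (simp add: T_pow_zseq)
    finally show ?thesis using FA[of zseq] unfolding subst_language_def
      by (intro CollectI bexI[of _ "F zseq 0"] exI[of _ "2 * m"]) (auto simp: m_def)
  qed
  have FX: "F x \<in> ?Y" if x: "x \<in> Xt" for x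
  proof -
    have "factor_at (F x) i n \<in> subst_language A \<alpha>" for i n
    proof -
      \<comment> \<open>The margin covers positions \<open>i - 1\<close> to
        \<open>i + n - 1\<close>, as the code looks one place to the left.\<close>
      define N where "N = nat \<bar>i\<bar> + n + 1"
      obtain c where c: "c \<ge> int N" "\<And>i. \<bar>i\<bar> \<le> int N \<Longrightarrow> x i = zseq (i + c)"
        using x unfolding Xt_iff by blast
      have "F x (i + int k) = F zseq (i + c + int k)" if "k < n" for k
      proof -
        have "x (i + int k) = zseq (i + int k + c)" "x (i + int k - 1) = zseq (i + int k - 1 + c)"
          using that by (intro c(2); simp add: N_def)+
        then show ?thesis unfolding F_def by (intro block_code_cong) (simp_all add: algebra_simps)
      qed
      then have "factor_at (F x) i n = factor_at (F zseq) (i + c) n" by (simp add: factor_at_eq_iff)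
      moreover have "i + c \<ge> 0" using c(1) by (simp add: N_def)
      ultimately show ?thesis using lang by simp
    qed
    then show ?thesis using FA by (auto simp: subst_shift_def)
  qed
  have "local_on Xt F" unfolding local_on_def
  proof
    fix j
    have "F x j = F y j" if "agree (nat \<bar>j\<bar> + 1) x y" for x y
      unfolding F_def using that by (intro block_code_cong) (simp_all add: agree_def)
    then show "\<exists>N. \<forall>x\<in>Xt. \<forall>y\<in>Xt. agree N x y \<longrightarrow> F x j = F y j" by blast
  qed
  then have cont: "continuous_map (subst_top {0, 1} tau) (subst_top A \<alpha>) F"
    using FX by (subst curtis_hedlund_lyndon) auto
  have dense: "\<exists>x\<in>Xt. agree N y (F x)" if y: "y \<in> ?Y" for y N
  proof -
    have "factor_at y (- int N) (2 * N + 1) \<in> subst_language A \<alpha>"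
      using y by (simp add: subst_shift_def)
    then obtain a m where am: "a \<in> A" "sublist (factor_at y (- int N) (2 * N + 1)) (subst_iter \<alpha> m a)"
      by (auto simp: subst_language_def)
    \<comment> \<open>Every letter of \<open>A\<close> occurs in \<open>F zseq\<close>, so each
      iterate of a letter is a window of some \<open>F ((T ^^ m) zseq)\<close>.\<close>
    have "F zseq 1 = p" "F zseq 3 = q" "F zseq 2 = r" by (simp_all add: F_def block_code_def)
    then obtain c where "a = F zseq c" using am(1) A by auto
    then have sl: "sublist (factor_at y (- int N) (2 * N + 1))
        (factor_at (F ((T ^^ m) zseq)) (2 ^ m * c) (2 ^ m))"
      using am(2) iter[of m c] by simp
    obtain j where j: "factor_at y (- int N) (2 * N + 1) = factor_at (F ((T ^^ m) zseq)) j (2 * N + 1)"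
      using sublist_factor_atD[OF sl] unfolding length_factor_at by blast
    \<comment> \<open>Shifting by \<open>j + int N\<close> moves the window starting at
      \<open>j\<close> to one centred at the origin.\<close>
    have "agree N y (F (shift (j + int N) ((T ^^ m) zseq)))"
      unfolding agree_def
    proof (intro allI impI)
      fix i assume i: "\<bar>i\<bar> \<le> int N"
      then have k: "int (nat (i + int N)) = i + int N" "nat (i + int N) < 2 * N + 1" by auto
      show "y i = F (shift (j + int N) ((T ^^ m) zseq)) i"
        using j[unfolded factor_at_eq_iff, rule_format, OF k(2)] unfolding k(1)
        by (simp add: F_def block_code_shift algebra_simps)
    qed
    then show ?thesis
      using shift_in_subst_shift[OF tau.funpow_seq_subst_shift_in[OF z]] by blast
  qed
  have "compactin (subst_top A \<alpha>) (F ` Xt)"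
    using image_compactin[OF _ cont, of Xt] compact_space_subst_top[of "{0, 1::nat}" tau]
    by (simp add: compact_space_def)
  then have "closedin (subst_top A \<alpha>) (F ` Xt)"
    by (rule compactin_imp_closedin[OF Hausdorff_space_subst_top])
  then have op: "openin (subst_top A \<alpha>) (?Y - F ` Xt)" by (simp add: closedin_def)
  have surj: "F ` Xt = ?Y"
  proof
    show "?Y \<subseteq> F ` Xt"
    proof
      fix y assume y: "y \<in> ?Y"
      show "y \<in> F ` Xt"
      proof (rule ccontr)
        assume "y \<notin> F ` Xt"
        then obtain N where "\<forall>y'\<in>?Y. agree N y y' \<longrightarrow> y' \<in> ?Y - F ` Xt"
          using op y unfolding openin_subst_top_iff by blast
        then show False using dense[OF y, of N] FX by blast
      qed
    qed
  qed (use FX in blast)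
  have "homeomorphic_map (subst_top {0, 1} tau) (subst_top A \<alpha>) F"
    using cont compact_space_subst_top[of "{0, 1::nat}" tau] Hausdorff_space_subst_top surj
      inj_on_block_code[OF ne]
    by (intro continuous_imp_homeomorphic_map) (simp_all add: F_def)
  then obtain G where G: "homeomorphic_maps (subst_top {0, 1} tau) (subst_top A \<alpha>) F G"
    by (auto simp: homeomorphic_map_maps)
  then have "homeomorphic_map (subst_top A \<alpha>) (subst_top {0, 1} tau) G"
    by (meson homeomorphic_map_maps homeomorphic_maps_sym)
  moreover have "G (left_shift y) = left_shift (G y)" if y: "y \<in> ?Y" for y
  proof -
    have GF: "G (F x) = x" if "x \<in> Xt" for x
      using G that by (simp add: homeomorphic_maps_def)
    obtain x where x: "x \<in> Xt" "y = F x" using surj y by blast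
    have "shift 1 y = F (shift 1 x)" unfolding x(2) F_def by (rule block_code_shift[symmetric])
    then show ?thesis
      unfolding left_shift_eq_shift by (simp only: x(2) GF[OF x(1)] GF[OF shift_in_subst_shift[OF x(1)]])
  qed
  ultimately show ?thesis unfolding topologically_conjugate_def by auto
qed

section \<open>The three substitutions: membership and distinctness\<close>

lemma in_toeplitz_class_toeplitz: "in_toeplitz_class {1, 2} toeplitz"
proof -
  have "topologically_conjugate (subst_top {1, 2} toeplitz) left_shift (subst_top {0, 1} tau) left_shift"
    by (rule topologically_conjugate_tau[of _ 2 1 1]) (auto simp: toeplitz_def)
  moreover have "primitive_subst {1, 2} toeplitz"
    unfolding primitive_subst_def
    by (rule exI[of _ 2]) (simp add: subst_iter_def subst_word_def toeplitz_def numeral_2_eq_2)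
  ultimately show ?thesis
    by (simp add: in_toeplitz_class_def alphabet_def substitution_on_def constant_length_def toeplitz_def)
qed

lemma in_toeplitz_class_rotated_toeplitz: "in_toeplitz_class {1, 2} rotated_toeplitz"
proof -
  have "topologically_conjugate (subst_top {1, 2} rotated_toeplitz) left_shift (subst_top {0, 1} tau) left_shift"
    by (rule topologically_conjugate_tau[of _ 1 1 2]) (auto simp: rotated_toeplitz_def)
  moreover have "primitive_subst {1, 2} rotated_toeplitz"
    unfolding primitive_subst_def
    by (rule exI[of _ 2]) (simp add: subst_iter_def subst_word_def rotated_toeplitz_def numeral_2_eq_2)
  ultimately show ?thesis
    by (simp add: in_toeplitz_class_def alphabet_def substitution_on_def constant_length_def rotated_toeplitz_def)
qed

lemma in_toeplitz_class_toeplitz3: "in_toeplitz_class {1, 2, 3} toeplitz3"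
proof -
  have "topologically_conjugate (subst_top {1, 2, 3} toeplitz3) left_shift (subst_top {0, 1} tau) left_shift"
    by (rule topologically_conjugate_tau[of _ 3 2 1]) (auto simp: toeplitz3_def)
  moreover have "primitive_subst {1, 2, 3} toeplitz3"
    unfolding primitive_subst_def
    by (rule exI[of _ 2]) (simp add: subst_iter_def subst_word_def toeplitz3_def numeral_2_eq_2)
  ultimately show ?thesis
    by (simp add: in_toeplitz_class_def alphabet_def substitution_on_def constant_length_def toeplitz3_def)
qed

text \<open>The two images under \<open>toeplitz\<close> begin with the same letter, a property that
  survives renaming; those under \<open>rotated_toeplitz\<close> begin with different
  letters.\<close>

lemma not_same_toeplitz_rotated: "\<not> same_up_to_renaming {1, 2} toeplitz {1, 2} rotated_toeplitz"
proof
  assume "same_up_to_renaming {1, 2} toeplitz {1, 2} rotated_toeplitz"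
  then obtain \<phi> where \<phi>: "bij_betw \<phi> {1, 2} {1, 2}"
    "\<forall>a\<in>{1, 2}. rotated_toeplitz (\<phi> a) = map \<phi> (toeplitz a)"
    unfolding same_up_to_renaming_def by blast
  have "rotated_toeplitz (\<phi> 1) = [\<phi> 1, \<phi> 2]" "rotated_toeplitz (\<phi> 2) = [\<phi> 1, \<phi> 1]"
    using \<phi>(2) by (simp_all add: toeplitz_def)
  moreover have "\<phi> 1 \<in> {1, 2}" "\<phi> 2 \<in> {1, 2}" using \<phi>(1) by (auto simp: bij_betw_def)
  ultimately show False by (auto simp: rotated_toeplitz_def split: if_splits)
qed

lemma same_up_to_renaming_card: "same_up_to_renaming A \<alpha> B \<beta> \<Longrightarrow> card A = card B"
  unfolding same_up_to_renaming_def using bij_betw_same_card by blast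

theorem mainTheorem5:
  shows "in_toeplitz_class {1, 2} toeplitz
       \<and> in_toeplitz_class {1, 2} rotated_toeplitz
       \<and> in_toeplitz_class {1, 2, 3} toeplitz3
       \<and> \<not> same_up_to_renaming {1, 2} toeplitz {1, 2} rotated_toeplitz
       \<and> \<not> same_up_to_renaming {1, 2} toeplitz {1, 2, 3} toeplitz3
       \<and> \<not> same_up_to_renaming {1, 2} rotated_toeplitz {1, 2, 3} toeplitz3
       \<and> (\<forall>(A :: 'a set) \<beta>. in_toeplitz_class A \<beta> \<longrightarrow>
             same_up_to_renaming {1, 2} toeplitz A \<beta>
           \<or> same_up_to_renaming {1, 2} rotated_toeplitz A \<beta>
           \<or> same_up_to_renaming {1, 2, 3} toeplitz3 A \<beta>)"
proof -
  have "\<not> same_up_to_renaming {1, 2} \<alpha> {1, 2, 3} \<beta>" for \<alpha> \<beta> :: "nat \<Rightarrow> nat list"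
    using same_up_to_renaming_card[of "{1, 2::nat}" \<alpha> "{1, 2, 3::nat}" \<beta>] by auto
  then show ?thesis
    using in_toeplitz_class_toeplitz in_toeplitz_class_rotated_toeplitz in_toeplitz_class_toeplitz3
      not_same_toeplitz_rotated toeplitz_class_cases by blast
qed

end
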